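(* For any finite group $G$, the Burnside Tambara functor $\Omega$ on $G$ is domain-like.
   Context: $G$ is a finite group; ${}_G\mathrm{set}$ is the category of finite $G$-sets and $G$-equivariant maps. Rings and monoids are commutative with unit. Semi-Mackey functor $M=(M^*,M_* )$ on $G$: a contravariant functor $M^*$ and a covariant functor $M_*$ from ${}_G\mathrm{set}$ to sets with $M^*(X)=M_*(X)=:M(X)$ such that (a) $M^*$ sends finite coproducts to products; (b) for every pull-back square with $f\colon X\to Y$, $\eta\colon Y'\to Y$, $\xi\colon X'\to X$, $f'\colon X'\to Y'$ one has $M^*(\eta)M_*(f)=M_*(f')M^*(\xi)$. Each $M(X)$ is then a commutative monoid (operation $M_*(\nabla)$, $\nabla\colon X\amalg X\to X$ the folding map). It is a Mackey functor if all $M(X)$ are abelian groups. For $f\colon X\to Y$ and $p\colon A\to X$ put $\Pi_f(A)=\{(y,\sigma)\mid y\in Y,\ \sigma\colon f^{-1}(y)\to A \text{ a map of sets},\ p\circ\sigma=\mathrm{id}_{f^{-1}(y)}\}$ with $G$-action $g\cdot(y,\sigma)=(gy,{}^g\sigma)$, ${}^g\sigma(x)=g\sigma(g^{-1}x)$, and $\pi\colon\Pi_f(A)\to Y$, $\pi(y,\sigma)=y$. The exponential diagram of $f,p$ (up to isomorphism) also has $Z=X\times_Y\Pi_f(A)$, $\rho\colon Z\to\Pi_f(A)$ the projection, and $\lambda\colon Z\to A$, $\lambda(x,(y,\sigma))=\sigma(x)$. Tambara functor $T=(T^*,T_+,T_\bullet)$ on $G$: $T^*$ contravariant, $T_+,T_\bullet$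 covariant functors ${}_G\mathrm{set}\to\mathrm{Set}$ such that $(T^*,T_+)$ is a Mackey functor, $(T^*,T_\bullet)$ is a semi-Mackey functor, and $T_\bullet(f)T_+(p)=T_+(\pi)T_\bullet(\rho)T^*(\lambda)$ for every exponential diagram. Each $T(X)$ is a ring. For $f\colon X\to Y$ write $f^*=T^*(f)$, $f_+=T_+(f)$, $f_\bullet=T_\bullet(f)$. The Burnside Tambara functor $\Omega$: $\Omega(X)=K_0({}_G\mathrm{set}/X)$ is the Grothendieck ring of the category of finite $G$-sets over $X$ (sum = disjoint union, product = fiber product over $X$). For $f\colon X\to Y$, $f^*$ is induced by pull-back along $f$, $f_+$ by composition with $f$, and $f_\bullet$ is the map determined by $f_\bullet(A\overset{p}{\to}X)=(\Pi_f(A)\overset{\pi}{\to}Y)$ (extended to virtual $G$-sets by the Tambara structure). An ideal $\mathscr{I}$ of $T$ is a family of ideals $\mathscr{I}(X)\subseteq T(X)$ such that for every $f\colon X\to Y$: $f^*(\mathscr{I}(Y))\subseteq\mathscr{I}(X)$, $f_+(\mathscr{I}(X))\subseteq\mathscr{I}(Y)$, $f_\bullet(\mathscr{I}(X))\subseteq f_\bullet(0)+\mathscr{I}(Y)$. For $a\in T(A)$, $\langle a\rangle$ is the smallest ideal of $T$ containing $a$. The product of ideals is the ideal given by $(\mathscr{I}\mathscr{J})(X)=\{p_+(ab)\mid p\colon A\to X,\ a\in\mathscr{I}(A),\ b\in\mathscr{J}(A)\}$. An ideal $\mathfrak{p}\subsetneq T$ is prime if for all transitive $X,Y$ and all $a\in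 T(X)$, $b\in T(Y)$, $\langle a\rangle\langle b\rangle\subseteq\mathfrak{p}$ implies $a\in\mathfrak{p}(X)$ or $b\in\mathfrak{p}(Y)$. $T$ is domain-like if the zero ideal $(0)\subsetneq T$ is prime. *)

theory Defs
  imports "HOL-Algebra.Group_Action" "HOL-Algebra.Ideal"
begin

section \<open>Finite G-sets\<close>

record ('g, 'x) gset =
  pts :: "'x set"
  act :: "'g \<Rightarrow> 'x \<Rightarrow> 'x"

definition finite_gset :: "('g, 'm) monoid_scheme \<Rightarrow> ('g, 'x) gset \<Rightarrow> bool" where
  "finite_gset G X \<longleftrightarrow> finite (pts X) \<and> group_action G (pts X) (act X)"

definition transitive_gset :: "('g, 'm) monoid_scheme \<Rightarrow> ('g, 'x) gset \<Rightarrow> bool" where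
  "transitive_gset G X \<longleftrightarrow>
     finite_gset G X \<and> pts X \<noteq> {} \<and> transitive_action G (pts X) (act X)"

text \<open>
  Equivariant maps are taken to be extensional functions, so that equality of morphisms is
  equality of functions; composition is \<open>compose (pts X) g f\<close>.
\<close>

definition gmaps ::
  "('g, 'm) monoid_scheme \<Rightarrow> ('g, 'x) gset \<Rightarrow> ('g, 'y) gset \<Rightarrow> ('x \<Rightarrow> 'y) set" where
  "gmaps G X Y =
     {f \<in> pts X \<rightarrow>\<^sub>E pts Y. \<forall>g\<in>carrier G. \<forall>x\<in>pts X. f (act X g x) = act Y g (f x)}"

definition fiber :: "('g, 'x) gset \<Rightarrow> ('x \<Rightarrow> 'y) \<Rightarrow> 'y \<Rightarrow> 'x set" where
  "fiber X f y = {x \<in> pts X. f x = y}"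

definition sum_gset :: "('g, 'a) gset \<Rightarrow> ('g, 'b) gset \<Rightarrow> ('g, 'a + 'b) gset" where
  "sum_gset A B =
     \<lparr>pts = pts A <+> pts B,
      act = (\<lambda>g. \<lambda>z\<in>pts A <+> pts B. map_sum (act A g) (act B g) z)\<rparr>"

definition fibprod_pts ::
  "('g, 'a) gset \<Rightarrow> ('a \<Rightarrow> 'x) \<Rightarrow> ('g, 'b) gset \<Rightarrow> ('b \<Rightarrow> 'x) \<Rightarrow> ('a \<times> 'b) set" where
  "fibprod_pts A p B q = {(a, b). a \<in> pts A \<and> b \<in> pts B \<and> p a = q b}"

definition fibprod_gset ::
  "('g, 'a) gset \<Rightarrow> ('a \<Rightarrow> 'x) \<Rightarrow> ('g, 'b) gset \<Rightarrow> ('b \<Rightarrow> 'x) \<Rightarrow> ('g, 'a \<times> 'b) gset" where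
  "fibprod_gset A p B q =
     \<lparr>pts = fibprod_pts A p B q,
      act = (\<lambda>g. \<lambda>z\<in>fibprod_pts A p B q. map_prod (act A g) (act B g) z)\<rparr>"

text \<open>The dependent product of \<open>p : A \<rightarrow> X\<close> along \<open>f : X \<rightarrow> Y\<close>; its structure map to \<open>Y\<close> is \<open>fst\<close>.\<close>

definition dprod_pts ::
  "('g, 'x) gset \<Rightarrow> ('g, 'y) gset \<Rightarrow> ('x \<Rightarrow> 'y) \<Rightarrow> ('g, 'a) gset \<Rightarrow> ('a \<Rightarrow> 'x)
     \<Rightarrow> ('y \<times> ('x \<Rightarrow> 'a)) set" where
  "dprod_pts X Y f A p =
     {(y, s). y \<in> pts Y \<and> s \<in> fiber X f y \<rightarrow>\<^sub>E pts A \<and> (\<forall>x\<in>fiber X f y. p (s x) = x)}"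

definition dprod_gset ::
  "('g, 'm) monoid_scheme \<Rightarrow> ('g, 'x) gset \<Rightarrow> ('g, 'y) gset \<Rightarrow> ('x \<Rightarrow> 'y)
     \<Rightarrow> ('g, 'a) gset \<Rightarrow> ('a \<Rightarrow> 'x) \<Rightarrow> ('g, 'y \<times> ('x \<Rightarrow> 'a)) gset" where
  "dprod_gset G X Y f A p =
     \<lparr>pts = dprod_pts X Y f A p,
      act = (\<lambda>g. \<lambda>(y, s)\<in>dprod_pts X Y f A p.
        (act Y g y, \<lambda>x\<in>fiber X f (act Y g y). act A g (s (act X (inv\<^bsub>G\<^esub> g) x))))\<rparr>"


section \<open>Semi-Mackey, Mackey and Tambara functors\<close>

text \<open>
  The category of finite G-sets is represented by the full subcategory of those finite G-sets whose
  underlying set consists of natural numbers. Every finite G-set is isomorphic to one of these,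
  so this is an equivalent category.
\<close>

type_synonym 'g obj = "('g, nat) gset"

definition is_coproduct ::
  "('g, 'm) monoid_scheme \<Rightarrow> 'g obj \<Rightarrow> 'g obj \<Rightarrow> 'g obj \<Rightarrow> (nat \<Rightarrow> nat) \<Rightarrow> (nat \<Rightarrow> nat) \<Rightarrow> bool" where
  "is_coproduct G X Y Z i j \<longleftrightarrow>
     finite_gset G X \<and> finite_gset G Y \<and> finite_gset G Z \<and>
     i \<in> gmaps G X Z \<and> j \<in> gmaps G Y Z \<and>
     bij_betw (case_sum i j) (pts X <+> pts Y) (pts Z)"

text \<open>
  The square with sides \<open>f : X \<rightarrow> Y\<close>, \<open>e : Y' \<rightarrow> Y\<close>, \<open>d : X' \<rightarrow> X\<close>, \<open>f' : X' \<rightarrow> Y'\<close>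
  (so \<open>f \<circ> d = e \<circ> f'\<close>) is a pull-back.
\<close>

definition is_pullback ::
  "('g, 'm) monoid_scheme \<Rightarrow> 'g obj \<Rightarrow> 'g obj \<Rightarrow> 'g obj \<Rightarrow> 'g obj
     \<Rightarrow> (nat \<Rightarrow> nat) \<Rightarrow> (nat \<Rightarrow> nat) \<Rightarrow> (nat \<Rightarrow> nat) \<Rightarrow> (nat \<Rightarrow> nat) \<Rightarrow> bool" where
  "is_pullback G X Y X' Y' f e d f' \<longleftrightarrow>
     finite_gset G X \<and> finite_gset G Y \<and> finite_gset G X' \<and> finite_gset G Y' \<and>
     f \<in> gmaps G X Y \<and> e \<in> gmaps G Y' Y \<and> d \<in> gmaps G X' X \<and> f' \<in> gmaps G X' Y' \<and>
     bij_betw (\<lambda>t. (d t, f' t)) (pts X') (fibprod_pts X f Y' e)"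

text \<open>
  The diagram \<open>Y \<leftarrow> P \<leftarrow> Z \<rightarrow> A\<close> with maps \<open>q\<close>, \<open>r\<close>, \<open>l\<close> is, up to an isomorphism
  \<open>(th, ze)\<close>, the canonical exponential diagram of \<open>f : X \<rightarrow> Y\<close> and \<open>p : A \<rightarrow> X\<close>.
\<close>

definition is_exponential ::
  "('g, 'm) monoid_scheme \<Rightarrow> 'g obj \<Rightarrow> 'g obj \<Rightarrow> 'g obj \<Rightarrow> (nat \<Rightarrow> nat) \<Rightarrow> (nat \<Rightarrow> nat)
     \<Rightarrow> 'g obj \<Rightarrow> 'g obj \<Rightarrow> (nat \<Rightarrow> nat) \<Rightarrow> (nat \<Rightarrow> nat) \<Rightarrow> (nat \<Rightarrow> nat) \<Rightarrow> bool" where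
  "is_exponential G X Y A f p P Z q r l \<longleftrightarrow>
     finite_gset G X \<and> finite_gset G Y \<and> finite_gset G A \<and> finite_gset G P \<and> finite_gset G Z \<and>
     f \<in> gmaps G X Y \<and> p \<in> gmaps G A X \<and>
     q \<in> gmaps G P Y \<and> r \<in> gmaps G Z P \<and> l \<in> gmaps G Z A \<and>
     (\<exists>th \<in> gmaps G P (dprod_gset G X Y f A p).
      \<exists>ze \<in> gmaps G Z (fibprod_gset X f (dprod_gset G X Y f A p) fst).
        bij_betw th (pts P) (dprod_pts X Y f A p) \<and>
        bij_betw ze (pts Z) (fibprod_pts X f (dprod_gset G X Y f A p) fst) \<and>
        (\<forall>w\<in>pts P. q w = fst (th w)) \<and>
        (\<forall>z\<in>pts Z. case ze z of (x, (y, s)) \<Rightarrow> th (r z) = (y, s) \<and> l z = s x))"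

text \<open>
  A semi-Mackey functor. For \<open>f : X \<rightarrow> Y\<close>, the map \<open>con X Y f : V Y \<rightarrow> V X\<close> is the contravariant
  and \<open>cov X Y f : V X \<rightarrow> V Y\<close> the covariant one. The value \<open>V X\<close> carries a monoid structure, which
  \<open>op_fold\<close> forces to be the one given by the folding map \<open>X + X \<rightarrow> X\<close>.
\<close>

locale semi_mackey_functor =
  fixes G :: "('g, 'm) monoid_scheme"
    and V :: "'g obj \<Rightarrow> ('r, 'n) monoid_scheme"
    and con :: "'g obj \<Rightarrow> 'g obj \<Rightarrow> (nat \<Rightarrow> nat) \<Rightarrow> 'r \<Rightarrow> 'r"
    and cov :: "'g obj \<Rightarrow> 'g obj \<Rightarrow> (nat \<Rightarrow> nat) \<Rightarrow> 'r \<Rightarrow> 'r"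
  assumes comm_monoid_V: "finite_gset G X \<Longrightarrow> comm_monoid (V X)"
    and con_closed:
      "\<lbrakk>finite_gset G X; finite_gset G Y; f \<in> gmaps G X Y\<rbrakk>
        \<Longrightarrow> con X Y f \<in> carrier (V Y) \<rightarrow> carrier (V X)"
    and con_id:
      "\<lbrakk>finite_gset G X; a \<in> carrier (V X)\<rbrakk> \<Longrightarrow> con X X (\<lambda>x\<in>pts X. x) a = a"
    and con_comp:
      "\<lbrakk>finite_gset G X; finite_gset G Y; finite_gset G Z;
        f \<in> gmaps G X Y; h \<in> gmaps G Y Z; a \<in> carrier (V Z)\<rbrakk>
        \<Longrightarrow> con X Z (compose (pts X) h f) a = con X Y f (con Y Z h a)"
    and cov_closed:
      "\<lbrakk>finite_gset G X; finite_gset G Y; f \<in> gmaps G X Y\<rbrakk>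
        \<Longrightarrow> cov X Y f \<in> carrier (V X) \<rightarrow> carrier (V Y)"
    and cov_id:
      "\<lbrakk>finite_gset G X; a \<in> carrier (V X)\<rbrakk> \<Longrightarrow> cov X X (\<lambda>x\<in>pts X. x) a = a"
    and cov_comp:
      "\<lbrakk>finite_gset G X; finite_gset G Y; finite_gset G Z;
        f \<in> gmaps G X Y; h \<in> gmaps G Y Z; a \<in> carrier (V X)\<rbrakk>
        \<Longrightarrow> cov X Z (compose (pts X) h f) a = cov Y Z h (cov X Y f a)"
    and con_empty:
      "\<lbrakk>finite_gset G X; pts X = {}\<rbrakk> \<Longrightarrow> \<exists>!a. a \<in> carrier (V X)"
    and con_coproduct:
      "is_coproduct G X Y Z i j
        \<Longrightarrow> bij_betw (\<lambda>a. (con X Z i a, con Y Z j a))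
              (carrier (V Z)) (carrier (V X) \<times> carrier (V Y))"
    and base_change:
      "\<lbrakk>is_pullback G X Y X' Y' f e d f'; a \<in> carrier (V X)\<rbrakk>
        \<Longrightarrow> con Y' Y e (cov X Y f a) = cov X' Y' f' (con X' X d a)"
    and op_fold:
      "\<lbrakk>is_coproduct G X X Z i j; h \<in> gmaps G Z X;
        \<And>x. x \<in> pts X \<Longrightarrow> h (i x) = x; \<And>x. x \<in> pts X \<Longrightarrow> h (j x) = x;
        a \<in> carrier (V Z)\<rbrakk>
        \<Longrightarrow> con X Z i a \<otimes>\<^bsub>V X\<^esub> con X Z j a = cov Z X h a"

locale mackey_functor = semi_mackey_functor G V con cov
  for G :: "('g, 'm) monoid_scheme"
    and V :: "'g obj \<Rightarrow> ('r, 'n) monoid_scheme"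
    and con cov +
  assumes comm_group_V: "finite_gset G X \<Longrightarrow> comm_group (V X)"

text \<open>
  For \<open>f : X \<rightarrow> Y\<close>, the maps \<open>f\<^sup>*\<close>, \<open>f\<^sub>+\<close> and \<open>f\<^sub>\<bullet>\<close> of \<open>T\<close> are
  \<open>tres T X Y f : T(Y) \<rightarrow> T(X)\<close>, \<open>ttr T X Y f : T(X) \<rightarrow> T(Y)\<close> and \<open>tnm T X Y f : T(X) \<rightarrow> T(Y)\<close>.
\<close>

record ('g, 'r) tambara_data =
  tval :: "'g obj \<Rightarrow> 'r ring"
  tres :: "'g obj \<Rightarrow> 'g obj \<Rightarrow> (nat \<Rightarrow> nat) \<Rightarrow> 'r \<Rightarrow> 'r"
  ttr :: "'g obj \<Rightarrow> 'g obj \<Rightarrow> (nat \<Rightarrow> nat) \<Rightarrow> 'r \<Rightarrow> 'r"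
  tnm :: "'g obj \<Rightarrow> 'g obj \<Rightarrow> (nat \<Rightarrow> nat) \<Rightarrow> 'r \<Rightarrow> 'r"

locale tambara_functor =
  fixes G :: "('g, 'm) monoid_scheme" and T :: "('g, 'r) tambara_data"
  assumes additive: "mackey_functor G (\<lambda>X. add_monoid (tval T X)) (tres T) (ttr T)"
    and multiplicative: "semi_mackey_functor G (tval T) (tres T) (tnm T)"
    and cring_val: "finite_gset G X \<Longrightarrow> cring (tval T X)"
    and exponential:
      "\<lbrakk>is_exponential G X Y A f p P Z q r l; a \<in> carrier (tval T A)\<rbrakk>
        \<Longrightarrow> tnm T X Y f (ttr T A X p a) = ttr T P Y q (tnm T Z P r (tres T Z A l a))"


section \<open>Ideals of Tambara functors\<close>

definition tambara_ideal ::
  "('g, 'm) monoid_scheme \<Rightarrow> ('g, 'r) tambara_data \<Rightarrow> ('g obj \<Rightarrow> 'r set) \<Rightarrow> bool" where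
  "tambara_ideal G T I \<longleftrightarrow>
     (\<forall>X. finite_gset G X \<longrightarrow> ideal (I X) (tval T X)) \<and>
     (\<forall>X Y f. finite_gset G X \<longrightarrow> finite_gset G Y \<longrightarrow> f \<in> gmaps G X Y \<longrightarrow>
        tres T X Y f ` I Y \<subseteq> I X \<and>
        ttr T X Y f ` I X \<subseteq> I Y \<and>
        tnm T X Y f ` I X \<subseteq> tnm T X Y f \<zero>\<^bsub>tval T X\<^esub> <+\<^bsub>tval T Y\<^esub> I Y)"

definition ideal_le ::
  "('g, 'm) monoid_scheme \<Rightarrow> ('g obj \<Rightarrow> 'r set) \<Rightarrow> ('g obj \<Rightarrow> 'r set) \<Rightarrow> bool" where
  "ideal_le G I J \<longleftrightarrow> (\<forall>X. finite_gset G X \<longrightarrow> I X \<subseteq> J X)"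

text \<open>The smallest ideal containing \<open>a \<in> T(A)\<close>.\<close>

definition gen_ideal ::
  "('g, 'm) monoid_scheme \<Rightarrow> ('g, 'r) tambara_data \<Rightarrow> 'g obj \<Rightarrow> 'r \<Rightarrow> 'g obj \<Rightarrow> 'r set" where
  "gen_ideal G T A a X = \<Inter> {I X | I. tambara_ideal G T I \<and> a \<in> I A}"

definition ideal_mult ::
  "('g, 'm) monoid_scheme \<Rightarrow> ('g, 'r) tambara_data
     \<Rightarrow> ('g obj \<Rightarrow> 'r set) \<Rightarrow> ('g obj \<Rightarrow> 'r set) \<Rightarrow> 'g obj \<Rightarrow> 'r set" where
  "ideal_mult G T I J X =
     {ttr T A X p (a \<otimes>\<^bsub>tval T A\<^esub> b) | A p a b.
        finite_gset G A \<and> p \<in> gmaps G A X \<and> a \<in> I A \<and> b \<in> J A}"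

definition tambara_prime ::
  "('g, 'm) monoid_scheme \<Rightarrow> ('g, 'r) tambara_data \<Rightarrow> ('g obj \<Rightarrow> 'r set) \<Rightarrow> bool" where
  "tambara_prime G T p \<longleftrightarrow>
     tambara_ideal G T p \<and>
     (\<exists>X. finite_gset G X \<and> p X \<noteq> carrier (tval T X)) \<and>
     (\<forall>X Y a b. transitive_gset G X \<longrightarrow> transitive_gset G Y \<longrightarrow>
        a \<in> carrier (tval T X) \<longrightarrow> b \<in> carrier (tval T Y) \<longrightarrow>
        ideal_le G (ideal_mult G T (gen_ideal G T X a) (gen_ideal G T Y b)) p \<longrightarrow>
        a \<in> p X \<or> b \<in> p Y)"

definition domain_like :: "('g, 'm) monoid_scheme \<Rightarrow> ('g, 'r) tambara_data \<Rightarrow> bool" where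
  "domain_like G T \<longleftrightarrow> tambara_prime G T (\<lambda>X. {\<zero>\<^bsub>tval T X\<^esub>})"


section \<open>The Grothendieck ring of a commutative semiring\<close>

definition groth_rel :: "('r, 'n) ring_scheme \<Rightarrow> (('r \<times> 'r) \<times> ('r \<times> 'r)) set" where
  "groth_rel R =
     {((a, b), (c, d)). a \<in> carrier R \<and> b \<in> carrier R \<and> c \<in> carrier R \<and> d \<in> carrier R \<and>
        (\<exists>e\<in>carrier R. (a \<oplus>\<^bsub>R\<^esub> d) \<oplus>\<^bsub>R\<^esub> e = (c \<oplus>\<^bsub>R\<^esub> b) \<oplus>\<^bsub>R\<^esub> e)}"

text \<open>The formal difference \<open>a - b\<close>.\<close>

definition fdiff :: "('r, 'n) ring_scheme \<Rightarrow> 'r \<Rightarrow> 'r \<Rightarrow> ('r \<times> 'r) set" where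
  "fdiff R a b = groth_rel R `` {(a, b)}"

definition groth_ring :: "('r, 'n) ring_scheme \<Rightarrow> ('r \<times> 'r) set ring" where
  "groth_ring R =
     \<lparr>carrier = (carrier R \<times> carrier R) // groth_rel R,
      mult = (\<lambda>U W. \<Union>(a, b)\<in>U. \<Union>(c, d)\<in>W.
        fdiff R (a \<otimes>\<^bsub>R\<^esub> c \<oplus>\<^bsub>R\<^esub> b \<otimes>\<^bsub>R\<^esub> d) (a \<otimes>\<^bsub>R\<^esub> d \<oplus>\<^bsub>R\<^esub> b \<otimes>\<^bsub>R\<^esub> c)),
      one = fdiff R \<one>\<^bsub>R\<^esub> \<zero>\<^bsub>R\<^esub>,
      zero = fdiff R \<zero>\<^bsub>R\<^esub> \<zero>\<^bsub>R\<^esub>,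
      add = (\<lambda>U W. \<Union>(a, b)\<in>U. \<Union>(c, d)\<in>W. fdiff R (a \<oplus>\<^bsub>R\<^esub> c) (b \<oplus>\<^bsub>R\<^esub> d))\<rparr>"

text \<open>The map induced on Grothendieck groups by an additive map \<open>h\<close> into \<open>S\<close>.\<close>

definition groth_map ::
  "('s, 'n) ring_scheme \<Rightarrow> ('r \<Rightarrow> 's) \<Rightarrow> ('r \<times> 'r) set \<Rightarrow> ('s \<times> 's) set" where
  "groth_map S h U = (\<Union>(a, b)\<in>U. fdiff S (h a) (h b))"


section \<open>The Burnside Tambara functor\<close>

type_synonym ('g, 'a) over = "('g, 'a) gset \<times> ('a \<Rightarrow> nat)"

definition is_over :: "('g, 'm) monoid_scheme \<Rightarrow> 'g obj \<Rightarrow> ('g, 'a) over \<Rightarrow> bool" where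
  "is_over G X U \<longleftrightarrow> finite_gset G (fst U) \<and> snd U \<in> gmaps G (fst U) X"

definition over_iso ::
  "('g, 'm) monoid_scheme \<Rightarrow> ('g, 'a) over \<Rightarrow> ('g, 'b) over \<Rightarrow> bool" where
  "over_iso G U W \<longleftrightarrow>
     (\<exists>h \<in> gmaps G (fst U) (fst W). bij_betw h (pts (fst U)) (pts (fst W)) \<and>
        (\<forall>a\<in>pts (fst U). snd W (h a) = snd U a))"

text \<open>
  The isomorphism class of a finite G-set over \<open>X\<close>. The representative \<open>U\<close> may have an arbitrary
  type of points, the members of the class have natural numbers as points.
\<close>

definition iso_class ::
  "('g, 'm) monoid_scheme \<Rightarrow> 'g obj \<Rightarrow> ('g, 'a) over \<Rightarrow> ('g, nat) over set" where
  "iso_class G X U = {W. is_over G X W \<and> over_iso G U W}"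

definition over_sum :: "('g, 'a) over \<Rightarrow> ('g, 'b) over \<Rightarrow> ('g, 'a + 'b) over" where
  "over_sum U W =
     (sum_gset (fst U) (fst W),
      \<lambda>z\<in>pts (fst U) <+> pts (fst W). case_sum (snd U) (snd W) z)"

definition over_prod :: "('g, 'a) over \<Rightarrow> ('g, 'b) over \<Rightarrow> ('g, 'a \<times> 'b) over" where
  "over_prod U W =
     (fibprod_gset (fst U) (snd U) (fst W) (snd W),
      \<lambda>z\<in>fibprod_pts (fst U) (snd U) (fst W) (snd W). snd U (fst z))"

definition over_empty :: "('g, nat) over" where
  "over_empty = (\<lparr>pts = {}, act = (\<lambda>g. \<lambda>x\<in>{}. x)\<rparr>, \<lambda>x\<in>{}. x)"

definition over_pull ::
  "'g obj \<Rightarrow> (nat \<Rightarrow> nat) \<Rightarrow> ('g, 'a) over \<Rightarrow> ('g, nat \<times> 'a) over" where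
  "over_pull X f U =
     (fibprod_gset X f (fst U) (snd U), \<lambda>z\<in>fibprod_pts X f (fst U) (snd U). fst z)"

definition over_push :: "(nat \<Rightarrow> nat) \<Rightarrow> ('g, 'a) over \<Rightarrow> ('g, 'a) over" where
  "over_push f U = (fst U, compose (pts (fst U)) f (snd U))"

definition over_dprod ::
  "('g, 'm) monoid_scheme \<Rightarrow> 'g obj \<Rightarrow> 'g obj \<Rightarrow> (nat \<Rightarrow> nat) \<Rightarrow> ('g, 'a) over
     \<Rightarrow> ('g, nat \<times> (nat \<Rightarrow> 'a)) over" where
  "over_dprod G X Y f U =
     (dprod_gset G X Y f (fst U) (snd U), \<lambda>w\<in>dprod_pts X Y f (fst U) (snd U). fst w)"

definition over_semiring ::
  "('g, 'm) monoid_scheme \<Rightarrow> 'g obj \<Rightarrow> ('g, nat) over set ring" where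
  "over_semiring G X =
     \<lparr>carrier = {iso_class G X U | U :: ('g, nat) over. is_over G X U},
      mult = (\<lambda>c d. \<Union>U\<in>c. \<Union>W\<in>d. iso_class G X (over_prod U W)),
      one = iso_class G X (X, \<lambda>x\<in>pts X. x),
      zero = iso_class G X over_empty,
      add = (\<lambda>c d. \<Union>U\<in>c. \<Union>W\<in>d. iso_class G X (over_sum U W))\<rparr>"

type_synonym 'g burnside_elt = "(('g, nat) over set \<times> ('g, nat) over set) set"

definition burnside_ring ::
  "('g, 'm) monoid_scheme \<Rightarrow> 'g obj \<Rightarrow> 'g burnside_elt ring" where
  "burnside_ring G X = groth_ring (over_semiring G X)"

text \<open>The element of the Burnside ring of \<open>X\<close> given by an actual finite G-set over \<open>X\<close>.\<close>

definition burnside_class ::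
  "('g, 'm) monoid_scheme \<Rightarrow> 'g obj \<Rightarrow> ('g, 'a) over \<Rightarrow> 'g burnside_elt" where
  "burnside_class G X U =
     fdiff (over_semiring G X) (iso_class G X U) \<zero>\<^bsub>over_semiring G X\<^esub>"

definition burnside_res ::
  "('g, 'm) monoid_scheme \<Rightarrow> 'g obj \<Rightarrow> 'g obj \<Rightarrow> (nat \<Rightarrow> nat)
     \<Rightarrow> 'g burnside_elt \<Rightarrow> 'g burnside_elt" where
  "burnside_res G X Y f =
     groth_map (over_semiring G X) (\<lambda>c. \<Union>U\<in>c. iso_class G X (over_pull X f U))"

definition burnside_tr ::
  "('g, 'm) monoid_scheme \<Rightarrow> 'g obj \<Rightarrow> 'g obj \<Rightarrow> (nat \<Rightarrow> nat)
     \<Rightarrow> 'g burnside_elt \<Rightarrow> 'g burnside_elt" where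
  "burnside_tr G X Y f =
     groth_map (over_semiring G Y) (\<lambda>c. \<Union>U\<in>c. iso_class G Y (over_push f U))"

text \<open>
  \<open>T\<close> is the Burnside Tambara functor: its values are the Burnside rings, \<open>f\<^sup>*\<close> and \<open>f\<^sub>+\<close> are induced
  by pull-back and composition, and \<open>f\<^sub>\<bullet>\<close> is given on actual G-sets by the dependent product. On
  virtual G-sets \<open>f\<^sub>\<bullet>\<close> is not additive; there it is determined by the requirement that these data
  form a Tambara functor (existence and uniqueness of this extension are due to Tambara).
\<close>

locale burnside_tambara_functor = tambara_functor G T
  for G :: "('g, 'm) monoid_scheme" and T :: "('g, 'g burnside_elt) tambara_data" +
  assumes val_burnside: "finite_gset G X \<Longrightarrow> tval T X = burnside_ring G X"
    and res_burnside:
      "\<lbrakk>finite_gset G X; finite_gset G Y; f \<in> gmaps G X Y; a \<in> carrier (burnside_ring G Y)\<rbrakk>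
        \<Longrightarrow> tres T X Y f a = burnside_res G X Y f a"
    and tr_burnside:
      "\<lbrakk>finite_gset G X; finite_gset G Y; f \<in> gmaps G X Y; a \<in> carrier (burnside_ring G X)\<rbrakk>
        \<Longrightarrow> ttr T X Y f a = burnside_tr G X Y f a"
    and nm_burnside:
      "\<lbrakk>finite_gset G X; finite_gset G Y; f \<in> gmaps G X Y;
        is_over G X (U :: ('g, nat) over)\<rbrakk>
        \<Longrightarrow> tnm T X Y f (burnside_class G X U) = burnside_class G Y (over_dprod G X Y f U)"

end

theory Submission
  imports Defs
begin

text \<open>
  An element of \<open>\<Omega>(X)\<close> is determined by its marks: for transitive \<open>S\<close> and \<open>e : S \<rightarrow> X\<close>, the mark of
  \<open>A \<rightarrow> X\<close> is the number of equivariant lifts \<open>S \<rightarrow> A\<close> of \<open>e\<close>. For \<open>f : S \<rightarrow> pt\<close> with \<open>S\<close> transitive, the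
  mark of \<open>f\<^sub>\<bullet> u\<close> at the point, which counts fixed points, equals the mark of \<open>u\<close> at the identity
  of \<open>S\<close>: both agree on actual G-sets, and although \<open>f\<^sub>\<bullet>\<close> is not additive, its mark at the point is,
  because \<open>S + S \<rightarrow> S\<close> has only two equivariant sections. Hence if \<open>a \<noteq> 0\<close> has a nonzero mark at
  \<open>e : S \<rightarrow> X\<close>, then \<open>f\<^sub>\<bullet>(e\<^sup>* a) - f\<^sub>\<bullet>(0)\<close> lies in \<open>\<langle>a\<rangle>(pt)\<close> and has a nonzero mark at the point. Marks are
  multiplicative, so two such elements have a nonzero product.
\<close>

section \<open>Constructions of finite G-sets\<close>

text \<open>The axioms prescribe \<open>f\<^sub>\<bullet>\<close> on actual G-sets but give no
  formula for it on formal differences, so it cannot be computed from representatives there. The way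
  around is to leave \<open>f\<^sub>\<bullet>\<close> abstract and to follow a single integer, its
  mark at the point: the exponential and base change axioms make this integer additive, and
  additivity pins it down on differences. Working over the point serves two purposes. Elements of
  the two generated ideals start over unrelated \<open>X\<close> and \<open>Y\<close>; over the
  point they meet in one ring, so the product of ideals can be tested with the identity as transfer
  map. And the mark at the point is a ring homomorphism from \<open>\<Omega>(pt)\<close> to the
  integers, which have no zero divisors, whereas \<open>\<Omega>(pt)\<close> itself has zero
  divisors for nontrivial \<open>G\<close>.\<close>

lemma (in group) finite_gsetI:
  assumes fin: "finite (pts X)"
    and clo: "\<And>g x. g \<in> carrier G \<Longrightarrow> x \<in> pts X \<Longrightarrow> act X g x \<in> pts X"
    and ext: "\<And>g. g \<in> carrier G \<Longrightarrow> act X g \<in> extensional (pts X)"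
    and one: "\<And>x. x \<in> pts X \<Longrightarrow> act X \<one> x = x"
    and mlt: "\<And>g h x. g \<in> carrier G \<Longrightarrow> h \<in> carrier G \<Longrightarrow> x \<in> pts X \<Longrightarrow>
                act X (g \<otimes> h) x = act X g (act X h x)"
  shows "finite_gset G X"
proof -
  \<comment> \<open>Inverses come from the group, so bijectivity of each \<open>act X g\<close> need
    not be assumed.\<close>
  have inv: "act X g (act X (inv g) x) = x" "act X (inv g) (act X g x) = x"
    if "g \<in> carrier G" "x \<in> pts X" for g x
    using mlt[of g "inv g" x] mlt[of "inv g" g x] one that by auto
  have bij: "act X g \<in> Bij (pts X)" if g: "g \<in> carrier G" for g
    unfolding Bij_def using ext[OF g] inv[OF g] clo g
    by (auto intro!: bij_betwI[where g = "act X (inv g)"])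
  have "act X (g \<otimes> h) = compose (pts X) (act X g) (act X h)"
    if g: "g \<in> carrier G" "h \<in> carrier G" for g h
    using mlt g ext[of "g \<otimes> h"] by (intro extensionalityI[of _ "pts X"]) (auto simp: compose_eq)
  then have "group_hom G (BijGroup (pts X)) (act X)"
    using bij by (intro group_hom.intro group_hom_axioms.intro homI group_BijGroup)
      (auto simp: BijGroup_def)
  then show ?thesis
    using fin by (simp add: finite_gset_def group_action_def)
qed

lemma finite_gset_finite [simp, intro]: "finite_gset G X \<Longrightarrow> finite (pts X)"
  by (simp add: finite_gset_def)

context group
begin

lemma act_closed [intro]:
  "finite_gset G X \<Longrightarrow> g \<in> carrier G \<Longrightarrow> x \<in> pts X \<Longrightarrow> act X g x \<in> pts X"
  using group_action.element_image unfolding finite_gset_def by metis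

lemma act_one: "finite_gset G X \<Longrightarrow> x \<in> pts X \<Longrightarrow> act X \<one> x = x"
  using group_action.id_eq_one[of G "pts X" "act X"] unfolding finite_gset_def
  by (metis restrict_apply')

lemma act_mult:
  "finite_gset G X \<Longrightarrow> g \<in> carrier G \<Longrightarrow> h \<in> carrier G \<Longrightarrow> x \<in> pts X \<Longrightarrow>
    act X (g \<otimes> h) x = act X g (act X h x)"
  using group_action.composition_rule unfolding finite_gset_def by metis

lemma act_inv:
  assumes "finite_gset G X" "g \<in> carrier G" "x \<in> pts X"
  shows "act X (inv g) (act X g x) = x" "act X g (act X (inv g) x) = x"
  using act_mult[OF assms(1), of "inv g" g x] act_mult[OF assms(1), of g "inv g" x] assms
  by (simp_all add: act_one)

lemma gmapsI:
  "\<lbrakk>f \<in> extensional (pts X); \<And>x. x \<in> pts X \<Longrightarrow> f x \<in> pts Y;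
    \<And>g x. g \<in> carrier G \<Longrightarrow> x \<in> pts X \<Longrightarrow> f (act X g x) = act Y g (f x)\<rbrakk>
    \<Longrightarrow> f \<in> gmaps G X Y"
  by (auto simp: gmaps_def PiE_def)

lemma gmaps_restrictI:
  "\<lbrakk>finite_gset G X; \<And>x. x \<in> pts X \<Longrightarrow> f x \<in> pts Y;
    \<And>g x. g \<in> carrier G \<Longrightarrow> x \<in> pts X \<Longrightarrow> f (act X g x) = act Y g (f x)\<rbrakk>
    \<Longrightarrow> restrict f (pts X) \<in> gmaps G X Y"
  by (auto intro!: gmapsI)

lemma gmaps_in: "f \<in> gmaps G X Y \<Longrightarrow> x \<in> pts X \<Longrightarrow> f x \<in> pts Y"
  by (auto simp: gmaps_def)

lemma gmaps_act:
  "f \<in> gmaps G X Y \<Longrightarrow> g \<in> carrier G \<Longrightarrow> x \<in> pts X \<Longrightarrow> f (act X g x) = act Y g (f x)"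
  by (auto simp: gmaps_def)

lemma gmaps_ext: "f \<in> gmaps G X Y \<Longrightarrow> f \<in> extensional (pts X)"
  by (auto simp: gmaps_def PiE_def)

lemma gmaps_eqI:
  "f \<in> gmaps G X Y \<Longrightarrow> f' \<in> gmaps G X Z \<Longrightarrow> (\<And>x. x \<in> pts X \<Longrightarrow> f x = f' x) \<Longrightarrow> f = f'"
  by (meson extensionalityI gmaps_ext)

lemma gmaps_compose:
  "\<lbrakk>finite_gset G X; f \<in> gmaps G X Y; h \<in> gmaps G Y Z\<rbrakk> \<Longrightarrow> compose (pts X) h f \<in> gmaps G X Z"
  unfolding compose_def by (rule gmaps_restrictI) (auto simp: gmaps_in gmaps_act)

lemma gmaps_id: "finite_gset G X \<Longrightarrow> (\<lambda>x\<in>pts X. x) \<in> gmaps G X X"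
  by (rule gmaps_restrictI) auto

lemma finite_gmaps:
  assumes "finite_gset G X" "finite_gset G Y" shows "finite (gmaps G X Y)"
  by (rule finite_subset[of _ "pts X \<rightarrow>\<^sub>E pts Y"]) (use assms in \<open>auto simp: gmaps_def intro: finite_PiE\<close>)

lemma gmaps_inv_into:
  assumes X: "finite_gset G X" and f: "f \<in> gmaps G X Y" and bij: "bij_betw f (pts X) (pts Y)"
    and Y: "finite_gset G Y"
  shows "restrict (inv_into (pts X) f) (pts Y) \<in> gmaps G Y X"
proof (rule gmaps_restrictI[OF Y])
  show "inv_into (pts X) f y \<in> pts X" if "y \<in> pts Y" for y
    using bij that by (metis bij_betw_imp_surj_on inv_into_into)
  fix g y assume g: "g \<in> carrier G" and y: "y \<in> pts Y"
  obtain x where x: "x \<in> pts X" "y = f x" using bij y by (auto simp: bij_betw_def)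
  have "act Y g y = f (act X g x)" using x f g by (simp add: gmaps_act)
  then show "inv_into (pts X) f (act Y g y) = act X g (inv_into (pts X) f y)"
    using x bij g X by (simp add: act_closed bij_betw_inv_into_left)
qed

section \<open>Transport of structure and models with natural numbers as points\<close>

lemma finite_gset_transport:
  assumes X: "finite_gset G X" and h: "bij_betw h (pts X) E"
  defines "k \<equiv> inv_into (pts X) h"
  shows "finite_gset G \<lparr>pts = E, act = (\<lambda>g. \<lambda>y\<in>E. h (act X g (k y)))\<rparr>" (is "finite_gset G ?Y")
    and "restrict h (pts X) \<in> gmaps G X \<lparr>pts = E, act = (\<lambda>g. \<lambda>y\<in>E. h (act X g (k y)))\<rparr>"
proof -
  have kh: "k (h x) = x" if "x \<in> pts X" for x
    using h that by (simp add: k_def bij_betw_inv_into_left)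
  have hin: "h x \<in> E" if "x \<in> pts X" for x using h that by (auto simp: bij_betw_def)
  have hk: "h (k y) = y" "k y \<in> pts X" if "y \<in> E" for y
    using h that by (auto simp: k_def bij_betw_inv_into_right bij_betw_def intro: inv_into_into)
  show Y: "finite_gset G ?Y"
    using X h bij_betw_finite[OF h]
    by (intro finite_gsetI) (auto simp: act_closed hin hk kh act_one act_mult)
  show "restrict h (pts X) \<in> gmaps G X ?Y"
    using X by (intro gmaps_restrictI) (auto simp: act_closed hin kh)
qed

text \<open>Functors are evaluated only on G-sets whose points are natural numbers, while sums,
  fibre products and dependent products have points of other types. Numbering the finite point set
  and carrying the action along brings them back.\<close>

lemma nat_model:
  assumes X: "finite_gset G X"
  obtains Y :: "'a obj" and h where "finite_gset G Y" "h \<in> gmaps G X Y" "bij_betw h (pts X) (pts Y)"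
proof -
  obtain h :: "_ \<Rightarrow> nat" where h: "bij_betw h (pts X) {0..<card (pts X)}"
    using X ex_bij_betw_finite_nat[of "pts X"] by auto
  show ?thesis
    using finite_gset_transport[OF X h] h that by force
qed

section \<open>Sums, fibre products and dependent products as finite G-sets\<close>

lemma finite_gset_sum:
  assumes "finite_gset G A" "finite_gset G B" shows "finite_gset G (sum_gset A B)"
  using assms by (intro finite_gsetI) (auto simp: sum_gset_def act_closed act_one act_mult)

lemma finite_gset_fibprod:
  assumes A: "finite_gset G A" and B: "finite_gset G B"
    and p: "p \<in> gmaps G A X" and q: "q \<in> gmaps G B X"
  shows "finite_gset G (fibprod_gset A p B q)"
proof (rule finite_gsetI)
  show "finite (pts (fibprod_gset A p B q))"
    by (rule finite_subset[of _ "pts A \<times> pts B"])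
      (use A B in \<open>auto simp: fibprod_gset_def fibprod_pts_def\<close>)
qed (use A B p q in \<open>auto simp: fibprod_gset_def fibprod_pts_def act_closed act_one act_mult gmaps_act\<close>)

lemma finite_gset_dprod:
  assumes X: "finite_gset G X" and Y: "finite_gset G Y" and A: "finite_gset G A"
    and f: "f \<in> gmaps G X Y" and p: "p \<in> gmaps G A X"
  shows "finite_gset G (dprod_gset G X Y f A p)"
proof (rule finite_gsetI)
  \<comment> \<open>Translation by \<open>g\<close> carries the fibre over \<open>y\<close> onto the
    fibre over \<open>g y\<close>; this is why the twisted action sends sections to
    sections.\<close>
  have fib: "act X (inv g) x \<in> fiber X f y \<longleftrightarrow> x \<in> fiber X f (act Y g y)"
    if "g \<in> carrier G" "y \<in> pts Y" "x \<in> pts X" for g x y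
    using that X f Y act_inv[OF Y, of g] act_inv[OF X, of g]
    by (auto simp: fiber_def act_closed gmaps_act gmaps_in)
  have fib': "x \<in> pts X" if "x \<in> fiber X f y" for x y using that by (auto simp: fiber_def)
  show "finite (pts (dprod_gset G X Y f A p))"
  proof (rule finite_subset)
    show "pts (dprod_gset G X Y f A p) \<subseteq> (SIGMA y:pts Y. fiber X f y \<rightarrow>\<^sub>E pts A)"
      by (auto simp: dprod_gset_def dprod_pts_def)
    show "finite (SIGMA y:pts Y. fiber X f y \<rightarrow>\<^sub>E pts A)"
      using X Y A by (intro finite_SigmaI finite_PiE) (auto simp: fiber_def)
  qed
  show closed: "act (dprod_gset G X Y f A p) g w \<in> pts (dprod_gset G X Y f A p)"
    if g: "g \<in> carrier G" and w: "w \<in> pts (dprod_gset G X Y f A p)" for g w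
  proof -
    obtain y s where ys: "w = (y, s)" by force
    have s: "s x \<in> pts A" "p (s x) = x" if "x \<in> fiber X f y" for x
      using w ys that by (auto simp: dprod_gset_def dprod_pts_def)
    have y: "y \<in> pts Y" using w ys by (auto simp: dprod_gset_def dprod_pts_def)
    have "act A g (s (act X (inv g) x)) \<in> pts A \<and> p (act A g (s (act X (inv g) x))) = x"
      if x: "x \<in> fiber X f (act Y g y)" for x
      using s[of "act X (inv g) x"] fib[OF g y] fib' x p A X g
      by (auto simp: act_closed gmaps_act act_inv)
    then show ?thesis
      using w g Y y by (auto simp: dprod_gset_def dprod_pts_def ys act_closed)
  qed
  show "act (dprod_gset G X Y f A p) g \<in> extensional (pts (dprod_gset G X Y f A p))" for g
    by (auto simp: dprod_gset_def)
  show "act (dprod_gset G X Y f A p) \<one> w = w"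
    if w: "w \<in> pts (dprod_gset G X Y f A p)" for w
  proof -
    obtain y s where ys: "w = (y, s)" by force
    have s: "s \<in> fiber X f y \<rightarrow>\<^sub>E pts A" and y: "y \<in> pts Y"
      using w ys by (auto simp: dprod_gset_def dprod_pts_def)
    have "restrict (\<lambda>x. act A \<one> (s (act X \<one> x))) (fiber X f y) = s"
    proof (rule extensionalityI[of _ "fiber X f y"])
      show "s \<in> extensional (fiber X f y)" using s by (simp add: PiE_def)
      fix x assume x: "x \<in> fiber X f y"
      then show "restrict (\<lambda>x. act A \<one> (s (act X \<one> x))) (fiber X f y) x = s x"
        by (simp add: act_one[OF X fib'[OF x]] act_one[OF A PiE_mem[OF s x]])
    qed simp
    then show ?thesis
      using w y by (auto simp: dprod_gset_def ys act_one[OF Y])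
  qed
  show "act (dprod_gset G X Y f A p) (g \<otimes> h) w =
      act (dprod_gset G X Y f A p) g (act (dprod_gset G X Y f A p) h w)"
    if g: "g \<in> carrier G" and h: "h \<in> carrier G" and w: "w \<in> pts (dprod_gset G X Y f A p)" for g h w
  proof -
    obtain y s where ys: "w = (y, s)" by force
    have s: "s \<in> fiber X f y \<rightarrow>\<^sub>E pts A" and y: "y \<in> pts Y"
      using w ys by (auto simp: dprod_gset_def dprod_pts_def)
    have hw: "act (dprod_gset G X Y f A p) h w \<in> dprod_pts X Y f A p"
      using closed[OF h w]
      by (simp add: dprod_gset_def)
    \<comment> \<open>The inner section is a restricted function, but it is evaluated only at
      \<open>inv g\<close> applied to a point of the fibre over \<open>g h y\<close>, which lies in
      the fibre over \<open>h y\<close>. The inverse of a product reverses the order, as the nested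
      twist requires.\<close>
    have "act A (g \<otimes> h) (s (act X (inv (g \<otimes> h)) x)) =
        act A g (restrict (\<lambda>x. act A h (s (act X (inv h) x))) (fiber X f (act Y h y)) (act X (inv g) x))"
      if x: "x \<in> fiber X f (act Y g (act Y h y))" for x
    proof -
      have x1: "act X (inv g) x \<in> fiber X f (act Y h y)"
        using fib[of g "act Y h y" x] x g h y Y fib' by (auto simp: act_closed)
      then have x2: "act X (inv h) (act X (inv g) x) \<in> fiber X f y"
        using fib[of h y] h y fib' by blast
      have "act X (inv (g \<otimes> h)) x = act X (inv h) (act X (inv g) x)"
        using g h X fib'[OF x] by (simp add: inv_mult_group act_mult)
      then show ?thesis using x1 by (simp add: act_mult[OF A g h PiE_mem[OF s x2]])
    qed
    then have r: "restrict (\<lambda>x. act A (g \<otimes> h) (s (act X (inv (g \<otimes> h)) x))) (fiber X f (act Y g (act Y h y))) =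
        restrict (\<lambda>x. act A g (restrict (\<lambda>x. act A h (s (act X (inv h) x))) (fiber X f (act Y h y)) (act X (inv g) x)))
          (fiber X f (act Y g (act Y h y)))"
      by (intro restrict_ext)
    have w': "(y, s) \<in> dprod_pts X Y f A p" using w ys by (simp add: dprod_gset_def)
    have "act (dprod_gset G X Y f A p) h w =
        (act Y h y, restrict (\<lambda>x. act A h (s (act X (inv h) x))) (fiber X f (act Y h y)))"
      using w' by (simp only: dprod_gset_def ys gset.simps restrict_apply' prod.case)
    with hw have "act (dprod_gset G X Y f A p) g (act (dprod_gset G X Y f A p) h w) =
        (act Y g (act Y h y), restrict (\<lambda>x. act A g (restrict (\<lambda>x. act A h (s (act X (inv h) x)))
          (fiber X f (act Y h y)) (act X (inv g) x))) (fiber X f (act Y g (act Y h y))))"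
      by (simp only: dprod_gset_def gset.simps restrict_apply' prod.case)
    moreover have "act (dprod_gset G X Y f A p) (g \<otimes> h) w =
        (act Y g (act Y h y), restrict (\<lambda>x. act A (g \<otimes> h) (s (act X (inv (g \<otimes> h)) x)))
          (fiber X f (act Y g (act Y h y))))"
      using w' by (simp only: dprod_gset_def ys gset.simps restrict_apply' prod.case act_mult[OF Y g h y])
    ultimately show ?thesis using r by (simp only:)
  qed
qed

end

section \<open>Counting lifts\<close>

text \<open>For \<open>S = G/H\<close> a map \<open>e\<close> to \<open>X\<close> is an
  \<open>H\<close>-fixed point of \<open>X\<close>, and its lifts are the \<open>H\<close>-fixed
  points in the fibre above it. Counting lifts thus gives the classical marks, relative to
  \<open>X\<close> and without choosing subgroups.\<close>

definition lifts ::
  "('g, 'm) monoid_scheme \<Rightarrow> 'g obj \<Rightarrow> (nat \<Rightarrow> nat) \<Rightarrow> ('g, 'a) over \<Rightarrow> (nat \<Rightarrow> 'a) set" where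
  "lifts G S e U = {s \<in> gmaps G S (fst U). \<forall>t\<in>pts S. snd U (s t) = e t}"

text \<open>An isomorphism over the base between parts \<open>E\<close> and \<open>F\<close> of two
  G-sets. Relativising to subsets lets orbits be removed inside fixed ambient G-sets, and
  \<open>h\<close> is unconstrained outside \<open>E\<close>, unlike the extensional maps in
  \<open>gmaps\<close>.\<close>

definition over_bij ::
  "('g, 'm) monoid_scheme \<Rightarrow> ('g, 'a) over \<Rightarrow> ('g, 'b) over \<Rightarrow> ('a \<Rightarrow> 'b) \<Rightarrow> 'a set \<Rightarrow> 'b set \<Rightarrow> bool"
  where
  "over_bij G U W h E F \<longleftrightarrow> bij_betw h E F \<and> (\<forall>a\<in>E. snd W (h a) = snd U a) \<and>
     (\<forall>g\<in>carrier G. \<forall>a\<in>E. h (act (fst U) g a) = act (fst W) g (h a))"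

definition invariant :: "('g, 'm) monoid_scheme \<Rightarrow> ('g, 'a) gset \<Rightarrow> 'a set \<Rightarrow> bool" where
  "invariant G A E \<longleftrightarrow> E \<subseteq> pts A \<and> (\<forall>g\<in>carrier G. \<forall>a\<in>E. act A g a \<in> E)"

definition orbit_gset :: "('g, 'm) monoid_scheme \<Rightarrow> ('g, 'a) gset \<Rightarrow> 'a \<Rightarrow> ('g, 'a) gset" where
  "orbit_gset G A a =
     \<lparr>pts = orbit G (act A) a, act = (\<lambda>g. restrict (act A g) (orbit G (act A) a))\<rparr>"

lemma is_overD:
  assumes "is_over G X U"
  shows "finite_gset G (fst U)" "snd U \<in> gmaps G (fst U) X"
  using assms by (auto simp: is_over_def)

lemma transitive_gsetD:
  assumes "transitive_gset G S"
  shows "finite_gset G S" "pts S \<noteq> {}"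
    "\<And>s t. s \<in> pts S \<Longrightarrow> t \<in> pts S \<Longrightarrow> \<exists>g\<in>carrier G. act S g s = t"
proof -
  show "finite_gset G S" "pts S \<noteq> {}" using assms by (simp_all add: transitive_gset_def)
  have "transitive_action G (pts S) (act S)" using assms by (simp add: transitive_gset_def)
  then show "\<exists>g\<in>carrier G. act S g s = t" if "s \<in> pts S" "t \<in> pts S" for s t
    using that by (rule transitive_action.unique_orbit)
qed

context group
begin

lemma transitive_gsetI:
  assumes "finite_gset G S" "pts S \<noteq> {}"
    "\<And>s t. s \<in> pts S \<Longrightarrow> t \<in> pts S \<Longrightarrow> \<exists>g\<in>carrier G. act S g s = t"
  shows "transitive_gset G S"
  unfolding transitive_gset_def transitive_action_def transitive_action_axioms_def
  using assms(1,2) assms(3) by (intro conjI allI impI) (simp_all add: finite_gset_def)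

lemma finite_lifts:
  "finite_gset G S \<Longrightarrow> finite_gset G (fst U) \<Longrightarrow> finite (lifts G S e U)"
  by (simp add: lifts_def finite_gmaps)

lemma invariant_orbit:
  assumes A: "finite_gset G A" and a: "a \<in> pts A"
  shows "invariant G A (orbit G (act A) a)"
  unfolding invariant_def
proof (intro conjI ballI)
  show "orbit G (act A) a \<subseteq> pts A" using A a by (auto simp: orbit_def act_closed)
  fix g b assume g: "g \<in> carrier G" and "b \<in> orbit G (act A) a"
  then obtain h where h: "h \<in> carrier G" "b = act A h a" by (auto simp: orbit_def)
  have "act A g b = act A (g \<otimes> h) a" using A a g h by (simp add: act_mult)
  then show "act A g b \<in> orbit G (act A) a" using g h by (auto simp: orbit_def)
qed

lemma orbit_minimal:
  assumes "invariant G A E" "a \<in> E" shows "orbit G (act A) a \<subseteq> E"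
  using assms by (auto simp: invariant_def orbit_def)

lemma orbit_self: "finite_gset G A \<Longrightarrow> a \<in> pts A \<Longrightarrow> a \<in> orbit G (act A) a"
  using act_one unfolding orbit_def by force

lemma invariant_act_iff:
  assumes A: "finite_gset G A" and E: "invariant G A E" and g: "g \<in> carrier G" and a: "a \<in> pts A"
  shows "act A g a \<in> E \<longleftrightarrow> a \<in> E"
  using assms act_inv(1)[OF A g a] unfolding invariant_def by (metis inv_closed)

lemma invariant_Diff:
  assumes A: "finite_gset G A" and "invariant G A E" "invariant G A F"
  shows "invariant G A (E - F)"
proof -
  have "act A g a \<in> E - F" if "g \<in> carrier G" "a \<in> E - F" for g a
    using that assms invariant_act_iff[OF A assms(3), of g a] by (auto simp: invariant_def)
  then show ?thesis using assms(2) by (auto simp: invariant_def)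
qed

lemma transitive_orbit_gset:
  assumes A: "finite_gset G A" and a: "a \<in> pts A"
  shows "transitive_gset G (orbit_gset G A a)"
proof (rule transitive_gsetI)
  have inv: "invariant G A (orbit G (act A) a)" by (rule invariant_orbit[OF A a])
  then have sub: "b \<in> pts A" if "b \<in> orbit G (act A) a" for b
    using that by (auto simp: invariant_def)
  have clo: "act A g b \<in> orbit G (act A) a" if "b \<in> orbit G (act A) a" "g \<in> carrier G" for g b
    using that inv by (auto simp: invariant_def)
  show "finite_gset G (orbit_gset G A a)"
  proof (rule finite_gsetI)
    show "finite (pts (orbit_gset G A a))"
      using sub A by (auto simp: orbit_gset_def intro: finite_subset[of _ "pts A"])
  qed (use A sub clo in \<open>auto simp: orbit_gset_def act_one act_mult\<close>)
  show "pts (orbit_gset G A a) \<noteq> {}"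
    using orbit_self[OF A a] by (auto simp: orbit_gset_def)
  fix s t assume "s \<in> pts (orbit_gset G A a)" "t \<in> pts (orbit_gset G A a)"
  then obtain g h where gh: "g \<in> carrier G" "h \<in> carrier G" "s = act A g a" "t = act A h a"
    and s: "s \<in> orbit G (act A) a"
    by (auto simp: orbit_def orbit_gset_def)
  have "act A (h \<otimes> inv g) s = t" using A a gh by (simp add: act_mult act_closed act_inv)
  then show "\<exists>k\<in>carrier G. act (orbit_gset G A a) k s = t"
    using gh s by (intro bexI[of _ "h \<otimes> inv g"]) (auto simp: orbit_gset_def)
qed

lemma over_bij_sym:
  assumes h: "over_bij G U W h E F" and E: "invariant G (fst U) E"
  shows "over_bij G W U (inv_into E h) F E"
proof -
  have bij: "bij_betw h E F" using h by (simp add: over_bij_def)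
  have hk: "h (inv_into E h b) = b" "inv_into E h b \<in> E" if "b \<in> F" for b
    using bij that by (auto simp: bij_betw_inv_into_right bij_betw_def intro: inv_into_into)
  have "inv_into E h (act (fst W) g b) = act (fst U) g (inv_into E h b)"
    if "b \<in> F" "g \<in> carrier G" for g b
  proof -
    have "act (fst W) g b = h (act (fst U) g (inv_into E h b))"
      using h hk[OF \<open>b \<in> F\<close>] that by (auto simp: over_bij_def)
    then show ?thesis
      using bij hk[OF \<open>b \<in> F\<close>] E that by (auto simp: invariant_def bij_betw_inv_into_left)
  qed
  moreover have "snd U (inv_into E h b) = snd W b" if "b \<in> F" for b
    using h hk[OF that] unfolding over_bij_def by metis
  ultimately show ?thesis
    using bij_betw_inv_into[OF bij] by (simp add: over_bij_def)
qed

text \<open>Postcomposition with \<open>h\<close> is injective on lifts. One inequality suffices: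
  the inverse of \<open>h\<close> is again such a bijection and gives the other one.\<close>

lemma card_lifts_le_of_over_bij:
  assumes S: "finite_gset G S" and W: "finite_gset G (fst W)"
    and h: "over_bij G U W h E F" and F: "invariant G (fst W) F"
  shows "card {s \<in> lifts G S e U. s ` pts S \<subseteq> E} \<le> card {s \<in> lifts G S e W. s ` pts S \<subseteq> F}"
proof (rule card_inj_on_le[of "\<lambda>s. compose (pts S) h s"])
  have hF: "h a \<in> F" "h a \<in> pts (fst W)" if "a \<in> E" for a
    using h F that by (auto simp: over_bij_def bij_betw_def invariant_def)
  show "inj_on (\<lambda>s. compose (pts S) h s) {s \<in> lifts G S e U. s ` pts S \<subseteq> E}"
  proof (rule inj_onI)
    fix s s' assume s: "s \<in> {s \<in> lifts G S e U. s ` pts S \<subseteq> E}"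
      "s' \<in> {s \<in> lifts G S e U. s ` pts S \<subseteq> E}"
      and eq: "compose (pts S) h s = compose (pts S) h s'"
    have "s t = s' t" if t: "t \<in> pts S" for t
    proof -
      have "h (s t) = h (s' t)" using eq t by (metis compose_eq)
      then show ?thesis using s h t by (auto simp: over_bij_def bij_betw_def inj_on_def)
    qed
    then show "s = s'" using s gmaps_eqI[of s S "fst U" s' "fst U"] by (auto simp: lifts_def)
  qed
  show "(\<lambda>s. compose (pts S) h s) ` {s \<in> lifts G S e U. s ` pts S \<subseteq> E}
    \<subseteq> {s \<in> lifts G S e W. s ` pts S \<subseteq> F}"
  proof clarify
    fix s assume s: "s \<in> lifts G S e U" "s ` pts S \<subseteq> E"
    have "compose (pts S) h s \<in> gmaps G S (fst W)"
      unfolding compose_def using s h S hF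
      by (intro gmaps_restrictI) (auto simp: lifts_def gmaps_act over_bij_def image_subset_iff)
    then show "compose (pts S) h s \<in> lifts G S e W \<and> compose (pts S) h s ` pts S \<subseteq> F"
      using s h hF by (auto simp: lifts_def over_bij_def compose_eq image_subset_iff)
  qed
  show "finite {s \<in> lifts G S e W. s ` pts S \<subseteq> F}" using finite_lifts[OF S W] by simp
qed

lemma card_lifts_eq_of_over_bij:
  assumes S: "finite_gset G S" and U: "finite_gset G (fst U)" and W: "finite_gset G (fst W)"
    and h: "over_bij G U W h E F" and E: "invariant G (fst U) E" and F: "invariant G (fst W) F"
  shows "card {s \<in> lifts G S e U. s ` pts S \<subseteq> E} = card {s \<in> lifts G S e W. s ` pts S \<subseteq> F}"
  by (rule le_antisym[OF card_lifts_le_of_over_bij[OF S W h F]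
        card_lifts_le_of_over_bij[OF S U over_bij_sym[OF h E] E]])

text \<open>Membership in the invariant set \<open>F\<close> does not change along an orbit, and
  \<open>S\<close> is a single orbit, so a lift lies wholly in \<open>F\<close> or wholly in
  \<open>E - F\<close>. As \<open>S\<close> is nonempty, no lift does both.\<close>

lemma card_lifts_split:
  assumes S: "transitive_gset G S" and U: "finite_gset G (fst U)"
    and E: "invariant G (fst U) E" and O: "invariant G (fst U) F" "F \<subseteq> E"
  shows "card {s \<in> lifts G S e U. s ` pts S \<subseteq> E} =
    card {s \<in> lifts G S e U. s ` pts S \<subseteq> F} + card {s \<in> lifts G S e U. s ` pts S \<subseteq> E - F}"
proof -
  note Sf = transitive_gsetD(1)[OF S]
  obtain t0 where t0: "t0 \<in> pts S" using transitive_gsetD(2)[OF S] by auto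
  have "s ` pts S \<subseteq> F \<or> s ` pts S \<subseteq> E - F"
    if s: "s \<in> lifts G S e U" "s ` pts S \<subseteq> E" for s
  proof -
    have "s t \<in> F \<longleftrightarrow> s t0 \<in> F" if t: "t \<in> pts S" for t
    proof -
      obtain g where g: "g \<in> carrier G" "act S g t0 = t"
        using transitive_gsetD(3)[OF S t0 t] by auto
      have "s t = act (fst U) g (s t0)" using s g t0 by (auto simp: lifts_def gmaps_act)
      moreover have "s t0 \<in> pts (fst U)" using s t0 by (auto simp: lifts_def gmaps_in)
      ultimately show ?thesis using invariant_act_iff[OF U O(1) g(1)] by simp
    qed
    then show ?thesis using s by auto
  qed
  then have "{s \<in> lifts G S e U. s ` pts S \<subseteq> E} =
    {s \<in> lifts G S e U. s ` pts S \<subseteq> F} \<union> {s \<in> lifts G S e U. s ` pts S \<subseteq> E - F}"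
    using O by auto
  moreover have "{s \<in> lifts G S e U. s ` pts S \<subseteq> F} \<inter> {s \<in> lifts G S e U. s ` pts S \<subseteq> E - F} = {}"
    using t0 by auto
  ultimately show ?thesis
    using finite_lifts[OF Sf U] by (simp add: card_Un_disjoint)
qed

section \<open>Counts of lifts determine a G-set over its base\<close>

lemma orbit_match:
  fixes U W :: "('a, nat) over"
  assumes U: "is_over G X U" and W: "is_over G X W"
    and E: "invariant G (fst U) E" and F: "invariant G (fst W) F"
    and card: "\<And>S e. transitive_gset G S \<Longrightarrow> e \<in> gmaps G S X \<Longrightarrow>
      card {s \<in> lifts G S e U. s ` pts S \<subseteq> E} = card {s \<in> lifts G S e W. s ` pts S \<subseteq> F}"
    and a: "a \<in> E"
    and min: "\<And>b. b \<in> F \<Longrightarrow> card (orbit G (act (fst U)) a) \<le> card (orbit G (act (fst W)) b)"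
  obtains b k where "b \<in> F"
    "over_bij G U W k (orbit G (act (fst U)) a) (orbit G (act (fst W)) b)"
proof -
  let ?A = "fst U" and ?B = "fst W"
  let ?O = "orbit G (act ?A) a"
  let ?S = "orbit_gset G ?A a"
  note Uf = is_overD[OF U] and Wf = is_overD[OF W]
  have aA: "a \<in> pts ?A" using a E by (auto simp: invariant_def)
  have S: "transitive_gset G ?S" by (rule transitive_orbit_gset[OF Uf(1) aA])
  note Sf = transitive_gsetD(1)[OF S]
  have pS: "pts ?S = ?O" by (simp add: orbit_gset_def)
  have aO: "a \<in> ?O" by (rule orbit_self[OF Uf(1) aA])
  have invO: "invariant G ?A ?O" by (rule invariant_orbit[OF Uf(1) aA])
  have sub: "b \<in> pts ?A" if "b \<in> ?O" for b using invO that by (auto simp: invariant_def)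
  have actS: "act ?S g b = act ?A g b" if "b \<in> ?O" for g b using that by (simp add: orbit_gset_def)
  let ?e = "restrict (snd U) ?O" and ?i = "\<lambda>x\<in>?O. x"
  have clo: "act ?A g b \<in> ?O" if "b \<in> ?O" "g \<in> carrier G" for g b
    using invO that by (auto simp: invariant_def)
  have e: "?e \<in> gmaps G ?S X"
    unfolding pS[symmetric] by (rule gmaps_restrictI[OF Sf])
      (use Uf sub in \<open>auto simp: pS actS gmaps_in gmaps_act\<close>)
  have "?i \<in> gmaps G ?S ?A"
    unfolding pS[symmetric] by (rule gmaps_restrictI[OF Sf]) (use sub in \<open>auto simp: pS actS\<close>)
  \<comment> \<open>The inclusion is a lift of \<open>?e\<close>, so the count on the side of
    \<open>U\<close> is positive, and equality of counts supplies a lift into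
    \<open>F\<close>.\<close>
  then have "?i \<in> {s \<in> lifts G ?S ?e U. s ` pts ?S \<subseteq> E}"
    using orbit_minimal[OF E a] by (auto simp: lifts_def pS)
  moreover have "finite {s \<in> lifts G ?S ?e U. s ` pts ?S \<subseteq> E}"
    using finite_lifts[OF Sf Uf(1)] by simp
  ultimately have "card {s \<in> lifts G ?S ?e U. s ` pts ?S \<subseteq> E} \<noteq> 0"
    by (subst card_0_eq) blast+
  then have "card {s \<in> lifts G ?S ?e W. s ` pts ?S \<subseteq> F} \<noteq> 0" using card[OF S e] by simp
  then obtain s where s: "s \<in> gmaps G ?S ?B" "s ` ?O \<subseteq> F"
    "\<And>t. t \<in> ?O \<Longrightarrow> snd W (s t) = snd U t"
    by (auto simp: lifts_def pS card_eq_0_iff)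
  have sact: "s (act ?A g t) = act ?B g (s t)" if "t \<in> ?O" "g \<in> carrier G" for g t
    using gmaps_act[OF s(1), of g t] that by (simp add: pS actS)
  have b: "s a \<in> F" using s(2) aO by auto
  have img: "s ` ?O = orbit G (act ?B) (s a)"
  proof -
    have "s ` ?O = (\<lambda>g. s (act ?A g a)) ` carrier G" by (auto simp: orbit_def)
    also have "\<dots> = (\<lambda>g. act ?B g (s a)) ` carrier G" by (rule image_cong) (auto simp: sact aO)
    finally show ?thesis by (auto simp: orbit_def)
  qed
  have finO: "finite ?O" using finite_gset_finite[OF Sf] pS by simp
  \<comment> \<open>The image of an orbit is an orbit and is no larger; \<open>min\<close> excludes
    a smaller one, and equal finite cardinalities make \<open>s\<close> injective.\<close>
  have "card (s ` ?O) = card ?O"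
    using min[OF b] card_image_le[OF finO, of s] img by simp
  then have "bij_betw s ?O (orbit G (act ?B) (s a))"
    using img finO by (auto simp: bij_betw_def intro: eq_card_imp_inj_on)
  then show ?thesis
    using that[OF b, of s] s sact by (auto simp: over_bij_def)
qed

text \<open>Both sides are peeled off orbit by orbit, starting with an orbit that is smallest among those
  of both sides: the inclusion of that orbit is counted, so it maps to the other side, and by
  minimality it maps isomorphically onto an orbit.\<close>

lemma over_bij_of_card_lifts:
  fixes U W :: "('a, nat) over"
  assumes U: "is_over G X U" and W: "is_over G X W"
    and E: "invariant G (fst U) E" and F: "invariant G (fst W) F"
    and card: "\<And>S e. transitive_gset G S \<Longrightarrow> e \<in> gmaps G S X \<Longrightarrow>
      card {s \<in> lifts G S e U. s ` pts S \<subseteq> E} = card {s \<in> lifts G S e W. s ` pts S \<subseteq> F}"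
  shows "\<exists>h. over_bij G U W h E F"
  using E F card
proof (induction "card E" arbitrary: E F rule: less_induct)
  case less
  let ?A = "fst U" and ?B = "fst W"
  let ?oA = "orbit G (act (fst U))" and ?oB = "orbit G (act (fst W))"
  note E = less.prems(1) and F = less.prems(2) and card = less.prems(3)
  note Uf = is_overD[OF U] and Wf = is_overD[OF W]
  have fE: "finite E" and fF: "finite F" and EA: "E \<subseteq> pts ?A" and FB: "F \<subseteq> pts ?B"
    using E F Uf Wf by (auto simp: invariant_def intro: finite_subset)
  show ?case
  proof (cases "E = {} \<and> F = {}")
    case True
    then show ?thesis by (auto simp: over_bij_def)
  next
    case False
    \<comment> \<open>Orbit sizes of both sides are pooled: whichever side attains the minimum, the
      matching argument can start from there, since the other side has no smaller orbit.\<close>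
    define N where "N = (\<lambda>a. card (?oA a)) ` E \<union> (\<lambda>b. card (?oB b)) ` F"
    have N: "finite N" "N \<noteq> {}" using False fE fF by (auto simp: N_def)
    have minN: "Min N \<le> n" if "n \<in> N" for n using N that by simp
    have "Min N \<in> N" using N by simp
    then consider a where "a \<in> E" "Min N = card (?oA a)" | b where "b \<in> F" "Min N = card (?oB b)"
      by (auto simp: N_def)
    then obtain a b k where ab: "a \<in> E" "b \<in> F" and k: "over_bij G U W k (?oA a) (?oB b)"
    proof cases
      case 1
      then have "card (?oA a) \<le> card (?oB b)" if "b \<in> F" for b
        using minN[of "card (?oB b)"] that by (auto simp: N_def)
      from orbit_match[OF U W E F card 1(1) this] 1(1) that show ?thesis by blast
    next
      case 2
      then have "card (?oB b) \<le> card (?oA a)" if "a \<in> E" for a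
        using minN[of "card (?oA a)"] that by (auto simp: N_def)
      from orbit_match[OF W U F E card[symmetric] 2(1) this]
      obtain a k where "a \<in> E" "over_bij G W U k (?oB b) (?oA a)" by blast
      with over_bij_sym[OF this(2) invariant_orbit[OF Wf(1)]] 2(1) FB that show ?thesis by blast
    qed
    have ia: "invariant G ?A (?oA a)" and ib: "invariant G ?B (?oB b)"
      using invariant_orbit[OF Uf(1)] invariant_orbit[OF Wf(1)] ab EA FB by auto
    have sa: "?oA a \<subseteq> E" and sb: "?oB b \<subseteq> F"
      using orbit_minimal[OF E ab(1)] orbit_minimal[OF F ab(2)] .
    have "a \<in> ?oA a" using orbit_self[OF Uf(1)] ab EA by auto
    then have "card (E - ?oA a) < card E"
      using ab(1) fE by (intro psubset_card_mono) auto
    moreover have iE: "invariant G ?A (E - ?oA a)" and iF: "invariant G ?B (F - ?oB b)"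
      using invariant_Diff Uf Wf E F ia ib by auto
    \<comment> \<open>The removed orbits are isomorphic and contribute equally to the two counts, so
      equality of counts survives the subtraction and the induction hypothesis applies.\<close>
    moreover have "card {s \<in> lifts G S e U. s ` pts S \<subseteq> E - ?oA a} =
        card {s \<in> lifts G S e W. s ` pts S \<subseteq> F - ?oB b}"
      if S: "transitive_gset G S" and e: "e \<in> gmaps G S X" for S e
      using card[OF S e] card_lifts_split[OF S Uf(1) E ia sa, of e]
        card_lifts_split[OF S Wf(1) F ib sb, of e]
        card_lifts_eq_of_over_bij[OF transitive_gsetD(1)[OF S] Uf(1) Wf(1) k ia ib, of e]
      by simp
    ultimately obtain h where h: "over_bij G U W h (E - ?oA a) (F - ?oB b)"
      using less.hyps by blast
    define m where "m x = (if x \<in> ?oA a then k x else h x)" for x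
    have "bij_betw m (?oA a \<union> (E - ?oA a)) (?oB b \<union> (F - ?oB b))"
    proof (rule bij_betw_combine)
      show "bij_betw m (?oA a) (?oB b)"
        using k by (auto simp: over_bij_def m_def cong: bij_betw_cong)
      have "bij_betw m (E - ?oA a) (F - ?oB b) \<longleftrightarrow> bij_betw h (E - ?oA a) (F - ?oB b)"
        by (rule bij_betw_cong) (auto simp: m_def)
      then show "bij_betw m (E - ?oA a) (F - ?oB b)" using h by (simp add: over_bij_def)
    qed auto
    moreover have "?oA a \<union> (E - ?oA a) = E" "?oB b \<union> (F - ?oB b) = F" using sa sb by auto
    ultimately have "bij_betw m E F" by simp
    moreover have "snd W (m x) = snd U x" if "x \<in> E" for x
      using that h k by (auto simp: over_bij_def m_def)
    moreover have "m (act ?A g x) = act ?B g (m x)" if "x \<in> E" "g \<in> carrier G" for g x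
      using that h k EA invariant_act_iff[OF Uf(1) ia, of g x] by (auto simp: over_bij_def m_def)
    ultimately show ?thesis by (auto simp: over_bij_def)
  qed
qed

end

definition cnt ::
  "('g, 'm) monoid_scheme \<Rightarrow> 'g obj \<Rightarrow> (nat \<Rightarrow> nat) \<Rightarrow> ('g, 'a) over \<Rightarrow> nat" where
  "cnt G S e U = card (lifts G S e U)"

text \<open>The one-point G-set has to be an object of the category, so its point is the number 0;
  an equivariant map \<open>e\<close> out of it amounts to the fixed point
  \<open>e 0\<close>.\<close>

definition point_gset :: "'g obj" where
  "point_gset = \<lparr>pts = {0}, act = (\<lambda>g. \<lambda>x\<in>{0}. x)\<rparr>"

definition to_point :: "'g obj \<Rightarrow> nat \<Rightarrow> nat" where
  "to_point S = (\<lambda>x\<in>pts S. 0)"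

context group
begin

lemma lifts_image: "s \<in> lifts G S e U \<Longrightarrow> s ` pts S \<subseteq> pts (fst U)"
  by (auto simp: lifts_def gmaps_in)

lemma cnt_eq_card_image: "cnt G S e U = card {s \<in> lifts G S e U. s ` pts S \<subseteq> pts (fst U)}"
  unfolding cnt_def using lifts_image by (intro arg_cong[where f = card]) blast

lemma invariant_pts: "finite_gset G A \<Longrightarrow> invariant G A (pts A)"
  by (auto simp: invariant_def act_closed)

text \<open>The two notions differ only in the behaviour of the map outside the points of
  \<open>fst U\<close>, which restriction normalises.\<close>

lemma over_iso_iff:
  assumes U: "finite_gset G (fst U)"
  shows "over_iso G U W \<longleftrightarrow> (\<exists>h. over_bij G U W h (pts (fst U)) (pts (fst W)))"
proof
  assume "over_iso G U W"
  then show "\<exists>h. over_bij G U W h (pts (fst U)) (pts (fst W))"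
    by (auto simp: over_iso_def over_bij_def gmaps_act)
next
  assume "\<exists>h. over_bij G U W h (pts (fst U)) (pts (fst W))"
  then obtain h where h: "over_bij G U W h (pts (fst U)) (pts (fst W))" ..
  have "h x \<in> pts (fst W)" if "x \<in> pts (fst U)" for x
    using h that by (auto simp: over_bij_def bij_betw_def)
  then have "restrict h (pts (fst U)) \<in> gmaps G (fst U) (fst W)"
    using h U by (intro gmaps_restrictI) (auto simp: over_bij_def)
  then show "over_iso G U W"
    using h unfolding over_iso_def over_bij_def
    by (intro bexI[of _ "restrict h (pts (fst U))"]) auto
qed

lemma over_iso_refl: "finite_gset G (fst U) \<Longrightarrow> over_iso G U U"
  by (subst over_iso_iff) (auto simp: over_bij_def intro!: exI[of _ id])

lemma over_iso_trans:
  assumes U: "finite_gset G (fst U)" and V: "finite_gset G (fst V)"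
    and "over_iso G U V" "over_iso G V W"
  shows "over_iso G U W"
proof -
  obtain h k where h: "over_bij G U V h (pts (fst U)) (pts (fst V))"
    and k: "over_bij G V W k (pts (fst V)) (pts (fst W))"
    using assms by (auto simp: over_iso_iff)
  have "h x \<in> pts (fst V)" if "x \<in> pts (fst U)" for x
    using h that by (auto simp: over_bij_def bij_betw_def)
  then have "over_bij G U W (k \<circ> h) (pts (fst U)) (pts (fst W))"
    using h k by (auto simp: over_bij_def intro: bij_betw_trans)
  then show ?thesis using over_iso_iff[OF U] by blast
qed

lemma cnt_over_iso:
  assumes "finite_gset G S" "finite_gset G (fst U)" "finite_gset G (fst W)" "over_iso G U W"
  shows "cnt G S e U = cnt G S e W"
proof -
  obtain h where h: "over_bij G U W h (pts (fst U)) (pts (fst W))"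
    using assms over_iso_iff by blast
  show ?thesis unfolding cnt_eq_card_image
    by (rule card_lifts_eq_of_over_bij[OF assms(1-3) h]) (auto intro: invariant_pts assms)
qed

text \<open>Burnside's theorem that marks classify finite G-sets, relative to the base
  \<open>X\<close>: the orbit argument applied to all points on both sides.\<close>

lemma over_iso_of_cnt:
  fixes U W :: "('a, nat) over"
  assumes U: "is_over G X U" and W: "is_over G X W"
    and "\<And>S e. transitive_gset G S \<Longrightarrow> e \<in> gmaps G S X \<Longrightarrow> cnt G S e U = cnt G S e W"
  shows "over_iso G U W"
  using over_bij_of_card_lifts[OF U W invariant_pts invariant_pts] assms(3)
    over_iso_iff[of U W] is_overD[OF U] is_overD[OF W]
  by (simp add: cnt_eq_card_image)

lemma nat_over:
  assumes U: "is_over G X U"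
  obtains W :: "('a, nat) over" where "is_over G X W" "over_iso G U W"
proof -
  note Uf = is_overD[OF U]
  obtain Y :: "'a obj" and h where Y: "finite_gset G Y" and h: "h \<in> gmaps G (fst U) Y"
    and bij: "bij_betw h (pts (fst U)) (pts Y)"
    by (rule nat_model[OF Uf(1)])
  let ?k = "restrict (inv_into (pts (fst U)) h) (pts Y)"
  let ?W = "(Y, compose (pts Y) (snd U) ?k)"
  have "is_over G X ?W"
    using gmaps_compose[OF Y gmaps_inv_into[OF Uf(1) h bij Y] Uf(2)] Y by (simp add: is_over_def)
  moreover have "over_iso G U ?W"
    unfolding over_iso_def using h bij gmaps_in[OF h]
    by (intro bexI[of _ h]) (auto simp: compose_eq bij_betw_inv_into_left)
  ultimately show ?thesis using that by blast
qed

text \<open>Describing a class by its counts turns identities between classes into identities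
  between numbers. Since \<open>U\<close> may have points of any type while the classification
  compares G-sets of natural numbers, the argument passes through a model \<open>V\<close> of
  \<open>U\<close>.\<close>

lemma iso_class_cnt:
  assumes U: "is_over G X U"
  shows "iso_class G X U = {W. is_over G X W \<and>
    (\<forall>S e. transitive_gset G S \<longrightarrow> e \<in> gmaps G S X \<longrightarrow> cnt G S e W = cnt G S e U)}"
proof (intro equalityI subsetI)
  note Uf = is_overD[OF U]
  show "W \<in> {W. is_over G X W \<and>
      (\<forall>S e. transitive_gset G S \<longrightarrow> e \<in> gmaps G S X \<longrightarrow> cnt G S e W = cnt G S e U)}"
    if "W \<in> iso_class G X U" for W
  proof -
    have W: "is_over G X W" "over_iso G U W" using that by (auto simp: iso_class_def)
    then show ?thesis
      using cnt_over_iso[OF transitive_gsetD(1) Uf(1) is_overD(1)[OF W(1)] W(2), symmetric] by blast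
  qed
  fix W :: "('a, nat) over" assume W: "W \<in> {W. is_over G X W \<and>
      (\<forall>S e. transitive_gset G S \<longrightarrow> e \<in> gmaps G S X \<longrightarrow> cnt G S e W = cnt G S e U)}"
  obtain V :: "('a, nat) over" where V: "is_over G X V" "over_iso G U V" by (rule nat_over[OF U])
  note Vf = is_overD[OF V(1)]
  have "over_iso G V W"
  proof (rule over_iso_of_cnt)
    show "is_over G X V" "is_over G X W" using V W by auto
    show "cnt G S e V = cnt G S e W" if "transitive_gset G S" "e \<in> gmaps G S X" for S e
      using W that cnt_over_iso[OF transitive_gsetD(1)[OF that(1)] Uf(1) Vf(1) V(2), of e] by auto
  qed
  then show "W \<in> iso_class G X U"
    using over_iso_trans[OF Uf(1) Vf(1) V(2), of W] W by (auto simp: iso_class_def)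
qed

lemma iso_class_eqI:
  assumes "is_over G X U" "is_over G X W"
    "\<And>S e. transitive_gset G S \<Longrightarrow> e \<in> gmaps G S X \<Longrightarrow> cnt G S e U = cnt G S e W"
  shows "iso_class G X U = iso_class G X W"
  unfolding iso_class_cnt[OF assms(1)] iso_class_cnt[OF assms(2)] using assms(3) by auto

lemma iso_class_nonempty: "is_over G X U \<Longrightarrow> iso_class G X U \<noteq> {}"
  by (rule nat_over[of X U]) (auto simp: iso_class_def)

section \<open>Counts of the constructions\<close>

lemma is_over_sum:
  assumes "is_over G X U" "is_over G X W" shows "is_over G X (over_sum U W)"
proof -
  note Uf = is_overD[OF assms(1)] and Wf = is_overD[OF assms(2)]
  have "(\<lambda>z\<in>pts (sum_gset (fst U) (fst W)). case_sum (snd U) (snd W) z) \<in>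
      gmaps G (sum_gset (fst U) (fst W)) X"
    by (rule gmaps_restrictI[OF finite_gset_sum[OF Uf(1) Wf(1)]])
      (use Uf Wf in \<open>auto simp: sum_gset_def gmaps_in gmaps_act\<close>)
  then show ?thesis
    using finite_gset_sum[OF Uf(1) Wf(1)] by (auto simp: is_over_def over_sum_def sum_gset_def)
qed

text \<open>A transitive G-set is connected: its image lies in one of the two summands, so the lifts
  split accordingly.\<close>

lemma cnt_over_sum:
  assumes S: "transitive_gset G S" and U: "is_over G X U" and W: "is_over G X W"
  shows "cnt G S e (over_sum U W) = cnt G S e U + cnt G S e W"
proof -
  note Uf = is_overD[OF U] and Wf = is_overD[OF W] and V = is_overD[OF is_over_sum[OF U W]]
  let ?V = "over_sum U W" and ?A = "pts (fst U)" and ?B = "pts (fst W)"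
  have iA: "invariant G (fst ?V) (Inl ` ?A)" and iB: "invariant G (fst ?V) (Inr ` ?B)"
    using Uf Wf by (auto simp: invariant_def over_sum_def sum_gset_def act_closed)
  have hA: "over_bij G U ?V Inl ?A (Inl ` ?A)" and hB: "over_bij G W ?V Inr ?B (Inr ` ?B)"
    by (auto simp: over_bij_def over_sum_def sum_gset_def bij_betw_def)
  have eq: "pts (fst ?V) - Inl ` ?A = Inr ` ?B" and sub: "Inl ` ?A \<subseteq> pts (fst ?V)"
    by (auto simp: over_sum_def sum_gset_def)
  note Sf = transitive_gsetD(1)[OF S]
  show ?thesis
    unfolding cnt_eq_card_image[of S e]
      card_lifts_split[OF S V(1) invariant_pts[OF V(1)] iA sub] eq
      card_lifts_eq_of_over_bij[OF Sf Uf(1) V(1) hA invariant_pts[OF Uf(1)] iA]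
      card_lifts_eq_of_over_bij[OF Sf Wf(1) V(1) hB invariant_pts[OF Wf(1)] iB] ..
qed

lemma is_over_empty: "is_over G X over_empty"
proof -
  have "finite_gset G \<lparr>pts = {}, act = (\<lambda>g. \<lambda>x\<in>{}. x)\<rparr>" by (rule finite_gsetI) auto
  then show ?thesis by (auto simp: is_over_def over_empty_def gmaps_def)
qed

lemma cnt_over_empty:
  assumes "transitive_gset G S" shows "cnt G S e over_empty = 0"
  using transitive_gsetD(2)[OF assms] by (auto simp: cnt_def lifts_def over_empty_def gmaps_def)

lemma is_over_id: "finite_gset G X \<Longrightarrow> is_over G X (X, \<lambda>x\<in>pts X. x)"
  by (simp add: is_over_def gmaps_id)

lemma cnt_over_id:
  assumes e: "e \<in> gmaps G S X"
  shows "cnt G S e (X, \<lambda>x\<in>pts X. x) = 1"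
proof -
  have "lifts G S e (X, \<lambda>x\<in>pts X. x) = {e}"
  proof (intro equalityI subsetI)
    fix s assume s: "s \<in> lifts G S e (X, \<lambda>x\<in>pts X. x)"
    have "s = e"
      using s e by (intro gmaps_eqI[of s S X e X]) (auto simp: lifts_def gmaps_in)
    then show "s \<in> {e}" by simp
  qed (use e in \<open>auto simp: lifts_def gmaps_in\<close>)
  then show ?thesis by (simp add: cnt_def)
qed

lemma is_over_prod:
  assumes "is_over G X U" "is_over G X W" shows "is_over G X (over_prod U W)"
proof -
  note Uf = is_overD[OF assms(1)] and Wf = is_overD[OF assms(2)]
  let ?P = "fibprod_gset (fst U) (snd U) (fst W) (snd W)"
  have P: "finite_gset G ?P" by (rule finite_gset_fibprod[OF Uf(1) Wf(1) Uf(2) Wf(2)])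
  have "(\<lambda>z\<in>pts ?P. snd U (fst z)) \<in> gmaps G ?P X"
    by (rule gmaps_restrictI[OF P])
      (use Uf Wf in \<open>auto simp: fibprod_gset_def fibprod_pts_def gmaps_in gmaps_act\<close>)
  then show ?thesis
    using P by (auto simp: is_over_def over_prod_def fibprod_gset_def)
qed

text \<open>The universal property of the fibre product: a lift to it is a pair of lifts to the
  factors.\<close>

lemma cnt_over_prod:
  assumes S: "finite_gset G S" and U: "is_over G X U" and W: "is_over G X W"
  shows "cnt G S e (over_prod U W) = cnt G S e U * cnt G S e W"
proof -
  note Uf = is_overD[OF U] and Wf = is_overD[OF W]
  let ?P = "fibprod_gset (fst U) (snd U) (fst W) (snd W)"
  have P: "fst (over_prod U W) = ?P" by (simp add: over_prod_def)
  have "bij_betw (\<lambda>s. (compose (pts S) fst s, compose (pts S) snd s))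
      (lifts G S e (over_prod U W)) (lifts G S e U \<times> lifts G S e W)"
  proof (rule bij_betwI[where g = "\<lambda>(s, t). \<lambda>x\<in>pts S. (s x, t x)"])
    show "(\<lambda>s. (compose (pts S) fst s, compose (pts S) snd s)) \<in>
        lifts G S e (over_prod U W) \<rightarrow> lifts G S e U \<times> lifts G S e W"
    proof
      fix s assume s: "s \<in> lifts G S e (over_prod U W)"
      have sx: "s x \<in> fibprod_pts (fst U) (snd U) (fst W) (snd W)" if "x \<in> pts S" for x
        using s that gmaps_in[of s S ?P] by (auto simp: lifts_def P fibprod_gset_def)
      have sg: "s (act S g x) = map_prod (act (fst U) g) (act (fst W) g) (s x)"
        if "x \<in> pts S" "g \<in> carrier G" for g x
        using s that gmaps_act[of s S ?P g x] sx[OF that(1)]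
        by (auto simp: lifts_def P fibprod_gset_def)
      have se: "snd U (fst (s x)) = e x" if "x \<in> pts S" for x
        using s that sx[OF that] by (auto simp: lifts_def over_prod_def)
      have "snd W (snd (s x)) = e x" if "x \<in> pts S" for x
        using se[OF that] sx[OF that] by (auto simp: fibprod_pts_def)
      moreover have "compose (pts S) fst s \<in> gmaps G S (fst U)"
        unfolding compose_def
        by (rule gmaps_restrictI[OF S]) (use sx sg in \<open>fastforce simp: fibprod_pts_def\<close>)+
      moreover have "compose (pts S) snd s \<in> gmaps G S (fst W)"
        unfolding compose_def
        by (rule gmaps_restrictI[OF S]) (use sx sg in \<open>fastforce simp: fibprod_pts_def\<close>)+
      ultimately show "(compose (pts S) fst s, compose (pts S) snd s) \<in>
          lifts G S e U \<times> lifts G S e W"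
        using se by (auto simp: lifts_def compose_eq)
    qed
    show "(\<lambda>(s, t). \<lambda>x\<in>pts S. (s x, t x)) \<in>
        lifts G S e U \<times> lifts G S e W \<rightarrow> lifts G S e (over_prod U W)"
    proof clarify
      fix s t assume s: "s \<in> lifts G S e U" and t: "t \<in> lifts G S e W"
      have in_P: "(s x, t x) \<in> fibprod_pts (fst U) (snd U) (fst W) (snd W)" if "x \<in> pts S" for x
        using s t that by (auto simp: lifts_def fibprod_pts_def gmaps_in)
      have "(\<lambda>x\<in>pts S. (s x, t x)) \<in> gmaps G S ?P"
        by (rule gmaps_restrictI[OF S])
          (use s t in_P in \<open>auto simp: fibprod_gset_def lifts_def gmaps_act\<close>)
      then show "(\<lambda>x\<in>pts S. (s x, t x)) \<in> lifts G S e (over_prod U W)"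
        using s in_P by (auto simp: lifts_def over_prod_def)
    qed
    show "(case (compose (pts S) fst s, compose (pts S) snd s) of (s, t) \<Rightarrow> \<lambda>x\<in>pts S. (s x, t x)) = s"
      if "s \<in> lifts G S e (over_prod U W)" for s
      using that gmaps_ext[of s S ?P]
      by (auto simp: lifts_def P compose_def intro!: extensionalityI[of _ "pts S"])
    show "(compose (pts S) fst (case y of (s, t) \<Rightarrow> \<lambda>x\<in>pts S. (s x, t x)),
          compose (pts S) snd (case y of (s, t) \<Rightarrow> \<lambda>x\<in>pts S. (s x, t x))) = y"
      if "y \<in> lifts G S e U \<times> lifts G S e W" for y
      using that gmaps_ext[of "fst y" S "fst U"] gmaps_ext[of "snd y" S "fst W"]
      by (auto simp: lifts_def compose_def intro!: extensionalityI[of _ "pts S"])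
  qed
  then show ?thesis by (simp add: cnt_def bij_betw_same_card card_cartesian_product)
qed

lemma is_over_pull:
  assumes X: "finite_gset G X" and f: "f \<in> gmaps G X Y" and U: "is_over G Y U"
  shows "is_over G X (over_pull X f U)"
proof -
  note Uf = is_overD[OF U]
  let ?P = "fibprod_gset X f (fst U) (snd U)"
  have P: "finite_gset G ?P" by (rule finite_gset_fibprod[OF X Uf(1) f Uf(2)])
  have "(\<lambda>z\<in>pts ?P. fst z) \<in> gmaps G ?P X"
    by (rule gmaps_restrictI[OF P]) (auto simp: fibprod_gset_def fibprod_pts_def)
  then show ?thesis
    using P by (auto simp: is_over_def over_pull_def fibprod_gset_def)
qed

text \<open>A lift of \<open>e\<close> to the pull-back has first component \<open>e\<close>; only
  the second component is free, and it lifts the composite of \<open>e\<close> with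
  \<open>f\<close>.\<close>

lemma cnt_over_pull:
  assumes S: "finite_gset G S" and e: "e \<in> gmaps G S X"
  shows "cnt G S e (over_pull X f U) = cnt G S (compose (pts S) f e) U"
proof -
  let ?P = "fibprod_gset X f (fst U) (snd U)"
  have P: "fst (over_pull X f U) = ?P" by (simp add: over_pull_def)
  have "bij_betw (\<lambda>s. compose (pts S) snd s)
      (lifts G S e (over_pull X f U)) (lifts G S (compose (pts S) f e) U)"
  proof (rule bij_betwI[where g = "\<lambda>s. \<lambda>x\<in>pts S. (e x, s x)"])
    have sx: "s x \<in> fibprod_pts X f (fst U) (snd U)"
      if "s \<in> lifts G S e (over_pull X f U)" "x \<in> pts S" for x s
      using that gmaps_in[of s S ?P] by (auto simp: lifts_def P fibprod_gset_def)
    have se: "fst (s x) = e x"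
      if "s \<in> lifts G S e (over_pull X f U)" "x \<in> pts S" for x s
      using that sx[OF that] by (auto simp: lifts_def over_pull_def)
    show "(\<lambda>s. compose (pts S) snd s) \<in>
        lifts G S e (over_pull X f U) \<rightarrow> lifts G S (compose (pts S) f e) U"
    proof
      fix s assume s: "s \<in> lifts G S e (over_pull X f U)"
      have sg: "s (act S g x) = map_prod (act X g) (act (fst U) g) (s x)"
        if "x \<in> pts S" "g \<in> carrier G" for g x
        using s that gmaps_act[of s S ?P g x] sx[OF s that(1)]
        by (auto simp: lifts_def P fibprod_gset_def)
      have "snd U (snd (s x)) = f (e x)" if "x \<in> pts S" for x
        using se[OF s that] sx[OF s that] by (auto simp: fibprod_pts_def)
      moreover have "compose (pts S) snd s \<in> gmaps G S (fst U)"
        unfolding compose_def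
        by (rule gmaps_restrictI[OF S]) (use sx[OF s] sg in \<open>fastforce simp: fibprod_pts_def\<close>)+
      ultimately show "compose (pts S) snd s \<in> lifts G S (compose (pts S) f e) U"
        by (auto simp: lifts_def compose_eq)
    qed
    show "(\<lambda>s. \<lambda>x\<in>pts S. (e x, s x)) \<in>
        lifts G S (compose (pts S) f e) U \<rightarrow> lifts G S e (over_pull X f U)"
    proof
      fix s assume s: "s \<in> lifts G S (compose (pts S) f e) U"
      have in_P: "(e x, s x) \<in> fibprod_pts X f (fst U) (snd U)" if "x \<in> pts S" for x
        using s e that by (auto simp: lifts_def fibprod_pts_def gmaps_in compose_eq)
      have "(\<lambda>x\<in>pts S. (e x, s x)) \<in> gmaps G S ?P"
        by (rule gmaps_restrictI[OF S])
          (use s e in_P in \<open>auto simp: fibprod_gset_def lifts_def gmaps_act\<close>)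
      then show "(\<lambda>x\<in>pts S. (e x, s x)) \<in> lifts G S e (over_pull X f U)"
        using in_P by (auto simp: lifts_def over_pull_def)
    qed
    show "(\<lambda>x\<in>pts S. (e x, compose (pts S) snd s x)) = s"
      if "s \<in> lifts G S e (over_pull X f U)" for s
      using that gmaps_ext[of s S ?P] se[OF that]
      by (intro extensionalityI[of _ "pts S"]) (auto simp: lifts_def P compose_def prod_eq_iff)
    show "compose (pts S) snd (\<lambda>x\<in>pts S. (e x, s x)) = s"
      if "s \<in> lifts G S (compose (pts S) f e) U" for s
      using that gmaps_ext[of s S "fst U"]
      by (intro extensionalityI[of _ "pts S"]) (auto simp: lifts_def compose_def)
  qed
  then show ?thesis by (simp add: cnt_def bij_betw_same_card)
qed

lemma is_over_push:
  assumes "f \<in> gmaps G X Y" "is_over G X U"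
  shows "is_over G Y (over_push f U)"
  using assms gmaps_compose[of "fst U" "snd U" X f Y] by (simp add: is_over_def over_push_def)

text \<open>A lift of \<open>e\<close> to a composite
  \<open>A \<rightarrow> X \<rightarrow> Y\<close> passes through exactly one map \<open>e'\<close>
  from \<open>S\<close> to \<open>X\<close> above \<open>e\<close>. With \<open>X\<close> viewed as
  a G-set over \<open>Y\<close> by \<open>f\<close>, these \<open>e'\<close> are the lifts of
  \<open>e\<close> to \<open>(X, f)\<close>, and the lifts to \<open>A\<close> are sorted by
  them.\<close>

lemma cnt_over_push:
  assumes S: "finite_gset G S" and X: "finite_gset G X" and U: "is_over G X U"
  shows "cnt G S e (over_push f U) = (\<Sum>e'\<in>lifts G S e (X, f). cnt G S e' U)"
proof -
  note Uf = is_overD[OF U]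
  have "lifts G S e (over_push f U) = (\<Union>e'\<in>lifts G S e (X, f). lifts G S e' U)"
  proof (intro equalityI subsetI)
    fix s assume s: "s \<in> lifts G S e (over_push f U)"
    then have s': "s \<in> gmaps G S (fst U)" by (simp add: lifts_def over_push_def)
    have "compose (pts S) (snd U) s \<in> lifts G S e (X, f)"
      using s gmaps_compose[OF S s' Uf(2)] gmaps_in[OF s']
      by (auto simp: lifts_def over_push_def compose_eq)
    moreover have "s \<in> lifts G S (compose (pts S) (snd U) s) U"
      using s' by (simp add: lifts_def compose_eq)
    ultimately show "s \<in> (\<Union>e'\<in>lifts G S e (X, f). lifts G S e' U)" by blast
  next
    fix s assume "s \<in> (\<Union>e'\<in>lifts G S e (X, f). lifts G S e' U)"
    then show "s \<in> lifts G S e (over_push f U)"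
      by (auto simp: lifts_def over_push_def compose_eq gmaps_in)
  qed
  moreover have "finite (lifts G S e (X, f))" using finite_lifts[OF S, of "(X, f)"] X by simp
  moreover have "lifts G S e1 U \<inter> lifts G S e2 U = {}"
    if "e1 \<in> lifts G S e (X, f)" "e2 \<in> lifts G S e (X, f)" "e1 \<noteq> e2" for e1 e2
  proof (rule ccontr)
    assume "lifts G S e1 U \<inter> lifts G S e2 U \<noteq> {}"
    then have "e1 t = e2 t" if "t \<in> pts S" for t using that by (auto simp: lifts_def)
    then show False using that gmaps_eqI[of e1 S X e2 X] by (auto simp: lifts_def)
  qed
  ultimately show ?thesis
    unfolding cnt_def using finite_lifts[OF S Uf(1)] by (simp add: card_UN_disjoint)
qed

end

text \<open>Operations on classes are unions over all representatives. They are evaluated by showing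
  that every representative yields the same set and that a representative exists.\<close>

lemma UN_eqI:
  assumes "x \<in> A" and "\<And>y. y \<in> A \<Longrightarrow> f y = k"
  shows "(\<Union>y\<in>A. f y) = k"
proof -
  have "(\<Union>y\<in>A. f y) = (\<Union>y\<in>A. k)" using assms(2) by (intro SUP_cong refl)
  then show ?thesis using assms(1) by auto
qed

lemma UN_pair_eqI:
  assumes "(a, b) \<in> u" and "\<And>a' b'. (a', b') \<in> u \<Longrightarrow> F a' b' = k"
  shows "(\<Union>(a, b)\<in>u. F a b) = k"
  by (rule UN_eqI[OF assms(1)]) (use assms(2) in auto)

context group
begin

lemma is_over_dprod:
  assumes X: "finite_gset G X" and Y: "finite_gset G Y" and f: "f \<in> gmaps G X Y"
    and U: "is_over G X U"
  shows "is_over G Y (over_dprod G X Y f U)"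
proof -
  note Uf = is_overD[OF U]
  let ?P = "dprod_gset G X Y f (fst U) (snd U)"
  have P: "finite_gset G ?P" by (rule finite_gset_dprod[OF X Y Uf(1) f Uf(2)])
  have "(\<lambda>z\<in>pts ?P. fst z) \<in> gmaps G ?P Y"
    by (rule gmaps_restrictI[OF P]) (auto simp: dprod_gset_def dprod_pts_def)
  then show ?thesis
    using P by (auto simp: is_over_def over_dprod_def dprod_gset_def)
qed

lemma transitive_point: "transitive_gset G point_gset"
proof (rule transitive_gsetI)
  show "finite_gset G point_gset"
    by (rule finite_gsetI) (auto simp: point_gset_def)
qed (auto simp: point_gset_def)

lemma to_point: "finite_gset G S \<Longrightarrow> to_point S \<in> gmaps G S point_gset"
  by (rule gmapsI) (auto simp: to_point_def point_gset_def act_closed)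

text \<open>The fibre of \<open>to_point S\<close> is all of \<open>S\<close>, so points of the
  dependent product are set-theoretic sections of \<open>p\<close>, and the twisted action fixes
  such a section exactly if it is equivariant. Allowing any \<open>P\<close> with a bijection
  \<open>th\<close> covers both the dependent product itself and its model in an exponential
  diagram.\<close>

lemma bij_betw_fixed_points_sections:
  fixes A :: "('a, 'x) gset" and P :: "('a, 'p) gset"
  assumes S: "finite_gset G S" and A: "finite_gset G A" and p: "p \<in> gmaps G A S"
    and P: "finite_gset G P"
    and th: "th \<in> gmaps G P (dprod_gset G S point_gset (to_point S) A p)"
    and bij: "bij_betw th (pts P) (dprod_pts S point_gset (to_point S) A p)"
    and q: "\<And>w. w \<in> pts P \<Longrightarrow> q w = fst (th w)"
  shows "bij_betw (\<lambda>e. snd (th (e 0))) (lifts G point_gset (\<lambda>x\<in>{0}. x) (P, q))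
    (lifts G S (\<lambda>x\<in>pts S. x) (A, p))"
proof -
  let ?D = "dprod_gset G S point_gset (to_point S) A p"
  let ?Dp = "dprod_pts S point_gset (to_point S) A p"
  let ?L = "lifts G point_gset (\<lambda>x\<in>{0}. x) (P, q)"
  let ?M = "lifts G S (\<lambda>x\<in>pts S. x) (A, p)"
  have fib: "fiber S (to_point S) 0 = pts S" by (auto simp: fiber_def to_point_def)
  have pt: "pts point_gset = {0}" "act point_gset g 0 = 0" for g by (auto simp: point_gset_def)
  have Dp: "?Dp = {(y, s). y = 0 \<and> s \<in> pts S \<rightarrow>\<^sub>E pts A \<and> (\<forall>x\<in>pts S. p (s x) = x)}"
    unfolding dprod_pts_def pt using fib by auto
  have actD: "act ?D g (0, s) = (0, \<lambda>x\<in>pts S. act A g (s (act S (inv g) x)))"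
    if "(0, s) \<in> ?Dp" for g s
    using that by (simp only: dprod_gset_def gset.simps restrict_apply' prod.case pt fib)
  have e0: "e 0 \<in> pts P" "act P g (e 0) = e 0" "fst (th (e 0)) = 0"
    if "e \<in> ?L" "g \<in> carrier G" for e g
  proof -
    have e: "e \<in> gmaps G point_gset P" "q (e 0) = 0" using that by (auto simp: lifts_def pt)
    show e0: "e 0 \<in> pts P" using gmaps_in[OF e(1), of 0] by (simp add: pt)
    show "act P g (e 0) = e 0" using gmaps_act[OF e(1) that(2), of 0] by (simp add: pt)
    show "fst (th (e 0)) = 0" using q[OF e0] e by simp
  qed
  note e1 = e0[OF _ one_closed]
  show ?thesis unfolding bij_betw_def
  proof (intro conjI equalityI subsetI)
    show "inj_on (\<lambda>e. snd (th (e 0))) ?L"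
    proof (rule inj_onI)
      fix e e' assume e: "e \<in> ?L" "e' \<in> ?L" and eq: "snd (th (e 0)) = snd (th (e' 0))"
      have "th (e 0) = th (e' 0)" using eq e1(3)[OF e(1)] e1(3)[OF e(2)] by (simp add: prod_eq_iff)
      then have "e 0 = e' 0"
        using bij e1(1)[OF e(1)] e1(1)[OF e(2)] by (auto simp: bij_betw_def inj_on_def)
      then show "e = e'"
        using e gmaps_eqI[of e point_gset P e' P] by (auto simp: lifts_def pt)
    qed
  next
    fix s assume "s \<in> (\<lambda>e. snd (th (e 0))) ` ?L"
    then obtain e where e: "e \<in> ?L" "s = snd (th (e 0))" by auto
    have ths: "th (e 0) = (0, s)" using e1(3)[OF e(1)] e(2) by (simp add: prod_eq_iff)
    then have inD: "(0, s) \<in> ?Dp" using bij_betwE[OF bij] e1(1)[OF e(1)] by metis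
    have s: "s \<in> pts S \<rightarrow>\<^sub>E pts A" "\<forall>x\<in>pts S. p (s x) = x" using inD Dp by auto
    have "s (act S g x) = act A g (s x)" if g: "g \<in> carrier G" and x: "x \<in> pts S" for g x
    proof -
      have "(0, s) = act ?D g (0, s)"
        using gmaps_act[OF th g e1(1)[OF e(1)]] e0(2)[OF e(1) g] ths by simp
      \<comment> \<open>Evaluated at \<open>g x\<close>, the inverse translation cancels and
        fixedness becomes equivariance at \<open>x\<close>.\<close>
      then have "s = (\<lambda>x\<in>pts S. act A g (s (act S (inv g) x)))" using actD[OF inD] by simp
      from fun_cong[OF this, of "act S g x"] show ?thesis using S g x by (simp add: act_closed act_inv)
    qed
    then have "s \<in> gmaps G S A" using s by (auto simp: gmaps_def)
    then show "s \<in> ?M" using s by (simp add: lifts_def)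
  next
    fix s assume "s \<in> ?M"
    then have s: "s \<in> gmaps G S A" "\<forall>x\<in>pts S. p (s x) = x" by (auto simp: lifts_def)
    then have inD: "(0, s) \<in> ?Dp" by (simp add: Dp gmaps_def)
    then obtain w where w: "w \<in> pts P" "th w = (0, s)"
      using bij_betw_imp_surj_on[OF bij] by (metis image_iff)
    have "act P g w = w" if g: "g \<in> carrier G" for g
    proof -
      have "(\<lambda>x\<in>pts S. act A g (s (act S (inv g) x))) = s"
      proof (rule extensionalityI[of _ "pts S"])
        fix x assume x: "x \<in> pts S"
        have x': "act S (inv g) x \<in> pts S" using S g x by (simp add: act_closed)
        have "s x = act A g (s (act S (inv g) x))"
          using gmaps_act[OF s(1) g x'] act_inv(2)[OF S g x] by simp
        then show "(\<lambda>x\<in>pts S. act A g (s (act S (inv g) x))) x = s x" using x by simp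
      qed (use s gmaps_ext in auto)
      then have "th (act P g w) = th w"
        using gmaps_act[OF th g w(1)] w actD[OF inD] by simp
      then show ?thesis
        using bij w(1) act_closed[OF P g w(1)] by (auto simp: bij_betw_def inj_on_def)
    qed
    then have "(\<lambda>x\<in>{0}. w) \<in> ?L"
      using w q[OF w(1)] by (auto simp: lifts_def pt intro!: gmapsI)
    then show "s \<in> (\<lambda>e. snd (th (e 0))) ` ?L"
      using w by (intro image_eqI[of _ _ "\<lambda>x\<in>{0}. w"]) auto
  qed
qed

lemma cnt_over_dprod_point:
  assumes S: "finite_gset G S" and U: "is_over G S U"
  shows "cnt G point_gset (\<lambda>x\<in>{0}. x) (over_dprod G S point_gset (to_point S) U) =
    cnt G S (\<lambda>x\<in>pts S. x) U"
proof -
  note Uf = is_overD[OF U] and pt = transitive_gsetD(1)[OF transitive_point]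
  let ?D = "dprod_gset G S point_gset (to_point S) (fst U) (snd U)"
  have D: "finite_gset G ?D" by (rule finite_gset_dprod[OF S pt Uf(1) to_point[OF S] Uf(2)])
  have ptsD: "pts ?D = dprod_pts S point_gset (to_point S) (fst U) (snd U)"
    by (simp add: dprod_gset_def)
  have eq: "over_dprod G S point_gset (to_point S) U = (?D, restrict fst (pts ?D))"
    by (simp add: over_dprod_def ptsD)
  \<comment> \<open>Here \<open>P\<close> is the dependent product itself and \<open>th\<close> its
    identity map.\<close>
  show ?thesis
    unfolding cnt_def eq
    using bij_betw_fixed_points_sections[OF S Uf D gmaps_id[OF D], of "restrict fst (pts ?D)"]
    by (auto simp: ptsD bij_betw_def intro!: bij_betw_same_card)
qed

end

section \<open>Marks on the Burnside ring\<close>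

text \<open>The choice is harmless on classes in the carrier for \<open>X\<close>, whose members all
  have the same counts at a transitive \<open>S\<close> with \<open>e\<close> into
  \<open>X\<close>.\<close>

definition ccnt ::
  "('g, 'm) monoid_scheme \<Rightarrow> 'g obj \<Rightarrow> (nat \<Rightarrow> nat) \<Rightarrow> ('g, nat) over set \<Rightarrow> nat" where
  "ccnt G S e c = cnt G S e (SOME U. U \<in> c)"

text \<open>One coordinate of the map to the ghost ring, sending a formal difference to the
  difference of the counts. The chosen pair is immaterial on elements of the Burnside ring, by
  \<open>mark_mem\<close>.\<close>

definition mark ::
  "('g, 'm) monoid_scheme \<Rightarrow> 'g obj \<Rightarrow> (nat \<Rightarrow> nat) \<Rightarrow> 'g burnside_elt \<Rightarrow> int" where
  "mark G S e u = (case SOME w. w \<in> u of (c, d) \<Rightarrow> int (ccnt G S e c) - int (ccnt G S e d))"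

context group
begin

section \<open>Counts on the semiring of isomorphism classes\<close>

lemma ccnt_mem:
  assumes c: "c \<in> carrier (over_semiring G X)" and U: "U \<in> c"
    and S: "transitive_gset G S" "e \<in> gmaps G S X"
  shows "ccnt G S e c = cnt G S e U"
proof -
  obtain V :: "('a, nat) over" where V: "is_over G X V" "c = iso_class G X V"
    using c by (auto simp: over_semiring_def)
  have "cnt G S e W = cnt G S e V" if "W \<in> c" for W
    using that S unfolding V(2) iso_class_cnt[OF V(1)] by blast
  moreover have "(SOME U. U \<in> c) \<in> c" using U by (rule someI)
  ultimately show ?thesis using U by (simp add: ccnt_def)
qed

lemma carrier_over_semiringE:
  assumes "c \<in> carrier (over_semiring G X)"
  obtains U :: "('a, nat) over" where "is_over G X U" "U \<in> c" "c = iso_class G X U"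
proof -
  obtain U :: "('a, nat) over" where U: "is_over G X U" "c = iso_class G X U"
    using assms by (auto simp: over_semiring_def)
  then have "U \<in> c" using over_iso_refl[OF is_overD(1)[OF U(1)]] by (auto simp: iso_class_def)
  then show ?thesis using U that by blast
qed

lemma is_over_mem: "c \<in> carrier (over_semiring G X) \<Longrightarrow> U \<in> c \<Longrightarrow> is_over G X U"
  by (auto simp: over_semiring_def iso_class_def)

lemma iso_class_carrier:
  assumes "is_over G X U" shows "iso_class G X U \<in> carrier (over_semiring G X)"
proof -
  obtain W :: "('a, nat) over" where W: "is_over G X W" "over_iso G U W" by (rule nat_over[OF assms])
  have "iso_class G X U = iso_class G X W"
    using cnt_over_iso[OF transitive_gsetD(1) is_overD(1)[OF assms] is_overD(1)[OF W(1)] W(2)]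
    by (intro iso_class_eqI[OF assms W(1)]) auto
  then have "iso_class G X U \<in> {iso_class G X W | W :: ('a, nat) over. is_over G X W}"
    using W(1) by blast
  then show ?thesis by (simp add: over_semiring_def)
qed

lemma ccnt_iso_class:
  assumes U: "is_over G X U" and S: "transitive_gset G S" "e \<in> gmaps G S X"
  shows "ccnt G S e (iso_class G X U) = cnt G S e U"
proof -
  obtain W where W: "W \<in> iso_class G X U" using iso_class_nonempty[OF U] by auto
  then have "cnt G S e W = cnt G S e U" using S unfolding iso_class_cnt[OF U] by blast
  then show ?thesis using ccnt_mem[OF iso_class_carrier[OF U] W S] by simp
qed

text \<open>The counts of a sum depend only on the counts of the summands, and the counts determine
  the class; independence of representatives thus follows without constructing isomorphisms of
  sums.\<close>

lemma over_semiring_add: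
  assumes c: "c \<in> carrier (over_semiring G X)" "U \<in> c"
    and d: "d \<in> carrier (over_semiring G X)" "W \<in> d"
  shows "c \<oplus>\<^bsub>over_semiring G X\<^esub> d = iso_class G X (over_sum U W)"
proof -
  have eq: "iso_class G X (over_sum U' W') = iso_class G X (over_sum U W)" if "U' \<in> c" "W' \<in> d" for U' W'
  proof (rule iso_class_eqI)
    note mem = is_over_mem[OF c(1)] is_over_mem[OF d(1)]
    show "is_over G X (over_sum U' W')" "is_over G X (over_sum U W)"
      using mem that c d by (simp_all add: is_over_sum)
    fix S :: "'a obj" and e assume S: "transitive_gset G S" "e \<in> gmaps G S X"
    show "cnt G S e (over_sum U' W') = cnt G S e (over_sum U W)"
      unfolding cnt_over_sum[OF S(1) mem(1)[OF c(2)] mem(2)[OF d(2)]]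
        cnt_over_sum[OF S(1) mem(1)[OF that(1)] mem(2)[OF that(2)]]
        ccnt_mem[OF c S, symmetric] ccnt_mem[OF d S, symmetric]
        ccnt_mem[OF c(1) that(1) S, symmetric] ccnt_mem[OF d(1) that(2) S, symmetric] ..
  qed
  have "(\<Union>U'\<in>c. \<Union>W'\<in>d. iso_class G X (over_sum U' W')) = iso_class G X (over_sum U W)"
    by (intro UN_eqI[OF c(2)] UN_eqI[OF d(2)] eq)
  then show ?thesis by (simp add: over_semiring_def)
qed

lemma over_semiring_mult:
  assumes c: "c \<in> carrier (over_semiring G X)" "U \<in> c"
    and d: "d \<in> carrier (over_semiring G X)" "W \<in> d"
  shows "c \<otimes>\<^bsub>over_semiring G X\<^esub> d = iso_class G X (over_prod U W)"
proof -
  have eq: "iso_class G X (over_prod U' W') = iso_class G X (over_prod U W)" if "U' \<in> c" "W' \<in> d" for U' W'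
  proof (rule iso_class_eqI)
    note mem = is_over_mem[OF c(1)] is_over_mem[OF d(1)]
    show "is_over G X (over_prod U' W')" "is_over G X (over_prod U W)"
      using mem that c d by (simp_all add: is_over_prod)
    fix S :: "'a obj" and e assume S: "transitive_gset G S" "e \<in> gmaps G S X"
    show "cnt G S e (over_prod U' W') = cnt G S e (over_prod U W)"
      unfolding cnt_over_prod[OF transitive_gsetD(1)[OF S(1)] mem(1)[OF c(2)] mem(2)[OF d(2)]]
        cnt_over_prod[OF transitive_gsetD(1)[OF S(1)] mem(1)[OF that(1)] mem(2)[OF that(2)]]
        ccnt_mem[OF c S, symmetric] ccnt_mem[OF d S, symmetric]
        ccnt_mem[OF c(1) that(1) S, symmetric] ccnt_mem[OF d(1) that(2) S, symmetric] ..
  qed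
  have "(\<Union>U'\<in>c. \<Union>W'\<in>d. iso_class G X (over_prod U' W')) = iso_class G X (over_prod U W)"
    by (intro UN_eqI[OF c(2)] UN_eqI[OF d(2)] eq)
  then show ?thesis by (simp add: over_semiring_def)
qed

lemma over_semiring_closed:
  assumes c: "c \<in> carrier (over_semiring G X)" and d: "d \<in> carrier (over_semiring G X)"
  shows "c \<oplus>\<^bsub>over_semiring G X\<^esub> d \<in> carrier (over_semiring G X)"
    and "c \<otimes>\<^bsub>over_semiring G X\<^esub> d \<in> carrier (over_semiring G X)"
proof -
  obtain U W where U: "is_over G X U" "U \<in> c" and W: "is_over G X W" "W \<in> d"
    using c d by (meson carrier_over_semiringE)
  then show "c \<oplus>\<^bsub>over_semiring G X\<^esub> d \<in> carrier (over_semiring G X)"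
    "c \<otimes>\<^bsub>over_semiring G X\<^esub> d \<in> carrier (over_semiring G X)"
    using c d by (simp_all add: over_semiring_add over_semiring_mult iso_class_carrier
        is_over_sum is_over_prod)
qed

lemma ccnt_add_mult:
  assumes c: "c \<in> carrier (over_semiring G X)" and d: "d \<in> carrier (over_semiring G X)"
    and S: "transitive_gset G S" "e \<in> gmaps G S X"
  shows "ccnt G S e (c \<oplus>\<^bsub>over_semiring G X\<^esub> d) = ccnt G S e c + ccnt G S e d"
    and "ccnt G S e (c \<otimes>\<^bsub>over_semiring G X\<^esub> d) = ccnt G S e c * ccnt G S e d"
proof -
  obtain U W where U: "is_over G X U" "U \<in> c" and W: "is_over G X W" "W \<in> d"
    using c d by (meson carrier_over_semiringE)
  show "ccnt G S e (c \<oplus>\<^bsub>over_semiring G X\<^esub> d) = ccnt G S e c + ccnt G S e d"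
    using U W S by (simp add: over_semiring_add[OF c U(2) d W(2)] is_over_sum ccnt_iso_class
        cnt_over_sum[of S X] ccnt_mem[OF c U(2)] ccnt_mem[OF d W(2)])
  show "ccnt G S e (c \<otimes>\<^bsub>over_semiring G X\<^esub> d) = ccnt G S e c * ccnt G S e d"
    using U W S by (simp add: over_semiring_mult[OF c U(2) d W(2)] is_over_prod ccnt_iso_class
        cnt_over_prod[of S X] ccnt_mem[OF c U(2)] ccnt_mem[OF d W(2)] transitive_gsetD(1))
qed

lemma over_semiring_zero:
  "\<zero>\<^bsub>over_semiring G X\<^esub> \<in> carrier (over_semiring G X)"
  "transitive_gset G S \<Longrightarrow> e \<in> gmaps G S X \<Longrightarrow> ccnt G S e \<zero>\<^bsub>over_semiring G X\<^esub> = 0"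
proof -
  have z: "\<zero>\<^bsub>over_semiring G X\<^esub> = iso_class G X over_empty" by (simp add: over_semiring_def)
  show "\<zero>\<^bsub>over_semiring G X\<^esub> \<in> carrier (over_semiring G X)"
    unfolding z by (rule iso_class_carrier[OF is_over_empty])
  show "ccnt G S e \<zero>\<^bsub>over_semiring G X\<^esub> = 0" if "transitive_gset G S" "e \<in> gmaps G S X"
    unfolding z ccnt_iso_class[OF is_over_empty that] by (rule cnt_over_empty[OF that(1)])
qed

lemma ccnt_ext:
  assumes c: "c \<in> carrier (over_semiring G X)" and d: "d \<in> carrier (over_semiring G X)"
    and eq: "\<And>S e. transitive_gset G S \<Longrightarrow> e \<in> gmaps G S X \<Longrightarrow> ccnt G S e c = ccnt G S e d"
  shows "c = d"
proof -
  obtain U W where U: "is_over G X U" "U \<in> c" "c = iso_class G X U"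
    and W: "is_over G X W" "W \<in> d" "d = iso_class G X W"
    using c d by (meson carrier_over_semiringE)
  show ?thesis
    unfolding U(3) W(3) using eq ccnt_mem[OF c U(2)] ccnt_mem[OF d W(2)]
    by (intro iso_class_eqI[OF U(1) W(1)]) simp
qed

text \<open>In one direction the auxiliary summand of \<open>groth_rel\<close> cancels, because
  counts are numbers. In the other, equal counts already force equality of the two sums in the
  semiring, so zero serves as auxiliary summand. In effect, marks show that addition of isomorphism
  classes is cancellative.\<close>

lemma groth_rel_iff:
  "((a, b), (c, d)) \<in> groth_rel (over_semiring G X) \<longleftrightarrow>
    a \<in> carrier (over_semiring G X) \<and> b \<in> carrier (over_semiring G X) \<and>
    c \<in> carrier (over_semiring G X) \<and> d \<in> carrier (over_semiring G X) \<and>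
    (\<forall>S e. transitive_gset G S \<longrightarrow> e \<in> gmaps G S X \<longrightarrow>
      int (ccnt G S e a) - int (ccnt G S e b) = int (ccnt G S e c) - int (ccnt G S e d))"
  (is "?rel \<longleftrightarrow> ?R a \<and> ?R b \<and> ?R c \<and> ?R d \<and> ?eq")
proof (cases "?R a \<and> ?R b \<and> ?R c \<and> ?R d")
  case True
  then have R: "?R a" "?R b" "?R c" "?R d" by auto
  show ?thesis
  proof
    assume ?rel
    then obtain x where x: "?R x"
      "(a \<oplus>\<^bsub>over_semiring G X\<^esub> d) \<oplus>\<^bsub>over_semiring G X\<^esub> x =
       (c \<oplus>\<^bsub>over_semiring G X\<^esub> b) \<oplus>\<^bsub>over_semiring G X\<^esub> x"
      by (auto simp: groth_rel_def)
    have "int (ccnt G S e a) - int (ccnt G S e b) = int (ccnt G S e c) - int (ccnt G S e d)"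
      if S: "transitive_gset G S" "e \<in> gmaps G S X" for S e
      using arg_cong[OF x(2), of "ccnt G S e"] R x(1)
      by (simp add: ccnt_add_mult(1)[OF _ _ S] over_semiring_closed)
    then show "?R a \<and> ?R b \<and> ?R c \<and> ?R d \<and> ?eq" using R by blast
  next
    assume "?R a \<and> ?R b \<and> ?R c \<and> ?R d \<and> ?eq"
    then have eq: "int (ccnt G S e a) - int (ccnt G S e b) = int (ccnt G S e c) - int (ccnt G S e d)"
      if "transitive_gset G S" "e \<in> gmaps G S X" for S e using that by blast
    have "ccnt G S e (a \<oplus>\<^bsub>over_semiring G X\<^esub> d) = ccnt G S e (c \<oplus>\<^bsub>over_semiring G X\<^esub> b)"
      if S: "transitive_gset G S" "e \<in> gmaps G S X" for S e
      using eq[OF S] R by (simp add: ccnt_add_mult(1)[OF _ _ S])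
    then have "a \<oplus>\<^bsub>over_semiring G X\<^esub> d = c \<oplus>\<^bsub>over_semiring G X\<^esub> b"
      using R by (intro ccnt_ext) (auto simp: over_semiring_closed)
    then show ?rel
      using R over_semiring_zero(1) by (auto simp: groth_rel_def)
  qed
next
  case False
  then show ?thesis by (auto simp: groth_rel_def)
qed

section \<open>Elements of the Burnside ring and their marks\<close>

lemma mem_fdiff_iff:
  assumes "a \<in> carrier (over_semiring G X)" "b \<in> carrier (over_semiring G X)"
  shows "(c, d) \<in> fdiff (over_semiring G X) a b \<longleftrightarrow>
    c \<in> carrier (over_semiring G X) \<and> d \<in> carrier (over_semiring G X) \<and>
    (\<forall>S e. transitive_gset G S \<longrightarrow> e \<in> gmaps G S X \<longrightarrow>
      int (ccnt G S e a) - int (ccnt G S e b) = int (ccnt G S e c) - int (ccnt G S e d))"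
  using assms groth_rel_iff[of a b c d X] unfolding fdiff_def by blast

lemma fdiff_eqI:
  assumes "a \<in> carrier (over_semiring G X)" "b \<in> carrier (over_semiring G X)"
    "c \<in> carrier (over_semiring G X)" "d \<in> carrier (over_semiring G X)"
    and "\<And>S e. transitive_gset G S \<Longrightarrow> e \<in> gmaps G S X \<Longrightarrow>
      int (ccnt G S e a) - int (ccnt G S e b) = int (ccnt G S e c) - int (ccnt G S e d)"
  shows "fdiff (over_semiring G X) a b = fdiff (over_semiring G X) c d"
  using assms by (auto simp: mem_fdiff_iff)

lemma burnside_carrier_iff:
  "u \<in> carrier (burnside_ring G X) \<longleftrightarrow>
    (\<exists>c\<in>carrier (over_semiring G X). \<exists>d\<in>carrier (over_semiring G X). u = fdiff (over_semiring G X) c d)"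
  by (auto simp: burnside_ring_def groth_ring_def quotient_def fdiff_def)

lemma burnside_carrierE:
  assumes "u \<in> carrier (burnside_ring G X)"
  obtains c d where "c \<in> carrier (over_semiring G X)" "d \<in> carrier (over_semiring G X)"
    "(c, d) \<in> u" "u = fdiff (over_semiring G X) c d"
  using assms mem_fdiff_iff by (metis burnside_carrier_iff)

lemma mem_burnside:
  assumes "u \<in> carrier (burnside_ring G X)" "(c, d) \<in> u"
  shows "c \<in> carrier (over_semiring G X)" "d \<in> carrier (over_semiring G X)"
  using assms by (auto simp: burnside_carrier_iff mem_fdiff_iff)

lemma mark_mem:
  assumes u: "u \<in> carrier (burnside_ring G X)" and cd: "(c, d) \<in> u"
    and S: "transitive_gset G S" "e \<in> gmaps G S X"
  shows "mark G S e u = int (ccnt G S e c) - int (ccnt G S e d)"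
proof -
  obtain a b where ab: "a \<in> carrier (over_semiring G X)" "b \<in> carrier (over_semiring G X)"
    "u = fdiff (over_semiring G X) a b" using u by (auto simp: burnside_carrier_iff)
  obtain c' d' where cd': "(SOME w. w \<in> u) = (c', d')" by force
  have "(c', d') \<in> u" using someI[of "\<lambda>w. w \<in> u", OF cd] cd' by simp
  then have "int (ccnt G S e c') - int (ccnt G S e d') = int (ccnt G S e c) - int (ccnt G S e d)"
    using cd S unfolding ab(3) mem_fdiff_iff[OF ab(1,2)] by metis
  then show ?thesis by (simp add: mark_def cd')
qed

lemma fdiff_carrier:
  "c \<in> carrier (over_semiring G X) \<Longrightarrow> d \<in> carrier (over_semiring G X) \<Longrightarrow>
    fdiff (over_semiring G X) c d \<in> carrier (burnside_ring G X)"
  by (auto simp: burnside_carrier_iff)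

lemma mark_fdiff:
  assumes c: "c \<in> carrier (over_semiring G X)" and d: "d \<in> carrier (over_semiring G X)"
    and S: "transitive_gset G S" "e \<in> gmaps G S X"
  shows "mark G S e (fdiff (over_semiring G X) c d) = int (ccnt G S e c) - int (ccnt G S e d)"
  by (rule mark_mem[OF fdiff_carrier[OF c d] _ S]) (use c d in \<open>simp add: mem_fdiff_iff\<close>)

text \<open>Injectivity of the map to the ghost ring: an identity in a Burnside ring may be checked
  one mark at a time.\<close>

lemma mark_ext:
  assumes u: "u \<in> carrier (burnside_ring G X)" and v: "v \<in> carrier (burnside_ring G X)"
    and eq: "\<And>S e. transitive_gset G S \<Longrightarrow> e \<in> gmaps G S X \<Longrightarrow> mark G S e u = mark G S e v"
  shows "u = v"
proof -
  obtain a b c d where ab: "a \<in> carrier (over_semiring G X)" "b \<in> carrier (over_semiring G X)"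
    "(a, b) \<in> u" "u = fdiff (over_semiring G X) a b"
    and cd: "c \<in> carrier (over_semiring G X)" "d \<in> carrier (over_semiring G X)"
    "(c, d) \<in> v" "v = fdiff (over_semiring G X) c d"
    using u v by (meson burnside_carrierE)
  show ?thesis unfolding ab(4) cd(4)
    using eq mark_mem[OF u ab(3)] mark_mem[OF v cd(3)] by (intro fdiff_eqI ab(1,2) cd(1,2)) simp
qed

lemma burnside_add:
  assumes u: "u \<in> carrier (burnside_ring G X)" and v: "v \<in> carrier (burnside_ring G X)"
    and ab: "(a, b) \<in> u" and cd: "(c, d) \<in> v"
  shows "u \<oplus>\<^bsub>burnside_ring G X\<^esub> v = fdiff (over_semiring G X)
    (a \<oplus>\<^bsub>over_semiring G X\<^esub> c) (b \<oplus>\<^bsub>over_semiring G X\<^esub> d)"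
proof -
  have "fdiff (over_semiring G X) (a' \<oplus>\<^bsub>over_semiring G X\<^esub> c') (b' \<oplus>\<^bsub>over_semiring G X\<^esub> d') =
    fdiff (over_semiring G X) (a \<oplus>\<^bsub>over_semiring G X\<^esub> c) (b \<oplus>\<^bsub>over_semiring G X\<^esub> d)"
    if u': "(a', b') \<in> u" and v': "(c', d') \<in> v" for a' b' c' d'
  proof (rule fdiff_eqI)
    fix S :: "'a obj" and e assume S: "transitive_gset G S" "e \<in> gmaps G S X"
    show "int (ccnt G S e (a' \<oplus>\<^bsub>over_semiring G X\<^esub> c')) - int (ccnt G S e (b' \<oplus>\<^bsub>over_semiring G X\<^esub> d')) =
        int (ccnt G S e (a \<oplus>\<^bsub>over_semiring G X\<^esub> c)) - int (ccnt G S e (b \<oplus>\<^bsub>over_semiring G X\<^esub> d))"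
      using mark_mem[OF u ab S] mark_mem[OF u u' S] mark_mem[OF v cd S] mark_mem[OF v v' S]
        mem_burnside[OF u ab] mem_burnside[OF v cd] mem_burnside[OF u u'] mem_burnside[OF v v']
      by (simp add: ccnt_add_mult(1)[OF _ _ S])
  qed (use mem_burnside[OF u ab] mem_burnside[OF v cd] mem_burnside[OF u u'] mem_burnside[OF v v']
      in \<open>auto simp: over_semiring_closed\<close>)
  then show ?thesis
    unfolding burnside_ring_def groth_ring_def by (simp add: UN_pair_eqI[OF ab] UN_pair_eqI[OF cd])
qed

lemma burnside_mult:
  assumes u: "u \<in> carrier (burnside_ring G X)" and v: "v \<in> carrier (burnside_ring G X)"
    and ab: "(a, b) \<in> u" and cd: "(c, d) \<in> v"
  shows "u \<otimes>\<^bsub>burnside_ring G X\<^esub> v = fdiff (over_semiring G X)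
    (a \<otimes>\<^bsub>over_semiring G X\<^esub> c \<oplus>\<^bsub>over_semiring G X\<^esub> b \<otimes>\<^bsub>over_semiring G X\<^esub> d)
    (a \<otimes>\<^bsub>over_semiring G X\<^esub> d \<oplus>\<^bsub>over_semiring G X\<^esub> b \<otimes>\<^bsub>over_semiring G X\<^esub> c)" (is "_ = ?F a b c d")
proof -
  \<comment> \<open>The two parts of the product of formal differences depend on the
    representatives, but their difference depends only on \<open>x - y\<close> and
    \<open>z - w\<close>.\<close>
  have prod: "(x * z + y * w) - (x * w + y * z) = (x - y) * (z - w)" for x y z w :: int
    by (simp add: algebra_simps)
  have "?F a' b' c' d' = ?F a b c d"
    if u': "(a', b') \<in> u" and v': "(c', d') \<in> v" for a' b' c' d'
  proof (rule fdiff_eqI)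
    fix S :: "'a obj" and e assume S: "transitive_gset G S" "e \<in> gmaps G S X"
    have "int (ccnt G S e a') - int (ccnt G S e b') = int (ccnt G S e a) - int (ccnt G S e b)"
      "int (ccnt G S e c') - int (ccnt G S e d') = int (ccnt G S e c) - int (ccnt G S e d)"
      using mark_mem[OF u ab S] mark_mem[OF u u' S] mark_mem[OF v cd S] mark_mem[OF v v' S] by auto
    then show "int (ccnt G S e (a' \<otimes>\<^bsub>over_semiring G X\<^esub> c' \<oplus>\<^bsub>over_semiring G X\<^esub> b' \<otimes>\<^bsub>over_semiring G X\<^esub> d')) -
        int (ccnt G S e (a' \<otimes>\<^bsub>over_semiring G X\<^esub> d' \<oplus>\<^bsub>over_semiring G X\<^esub> b' \<otimes>\<^bsub>over_semiring G X\<^esub> c')) =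
        int (ccnt G S e (a \<otimes>\<^bsub>over_semiring G X\<^esub> c \<oplus>\<^bsub>over_semiring G X\<^esub> b \<otimes>\<^bsub>over_semiring G X\<^esub> d)) -
        int (ccnt G S e (a \<otimes>\<^bsub>over_semiring G X\<^esub> d \<oplus>\<^bsub>over_semiring G X\<^esub> b \<otimes>\<^bsub>over_semiring G X\<^esub> c))"
      using mem_burnside[OF u ab] mem_burnside[OF v cd] mem_burnside[OF u u'] mem_burnside[OF v v']
      by (simp add: ccnt_add_mult[OF _ _ S] over_semiring_closed prod)
  qed (use mem_burnside[OF u ab] mem_burnside[OF v cd] mem_burnside[OF u u'] mem_burnside[OF v v']
      in \<open>auto simp: over_semiring_closed\<close>)
  then show ?thesis
    unfolding burnside_ring_def groth_ring_def by (simp add: UN_pair_eqI[OF ab] UN_pair_eqI[OF cd])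
qed

section \<open>Marks of sums, products, restrictions and transfers\<close>

lemma mark_add:
  assumes u: "u \<in> carrier (burnside_ring G X)" and v: "v \<in> carrier (burnside_ring G X)"
    and S: "transitive_gset G S" "e \<in> gmaps G S X"
  shows "mark G S e (u \<oplus>\<^bsub>burnside_ring G X\<^esub> v) = mark G S e u + mark G S e v"
proof -
  obtain a b c d where ab: "a \<in> carrier (over_semiring G X)" "b \<in> carrier (over_semiring G X)" "(a, b) \<in> u"
    and cd: "c \<in> carrier (over_semiring G X)" "d \<in> carrier (over_semiring G X)" "(c, d) \<in> v"
    using u v by (meson burnside_carrierE)
  show ?thesis
    using ab cd
    by (simp add: burnside_add[OF u v ab(3) cd(3)] mark_fdiff[OF _ _ S] over_semiring_closed
        ccnt_add_mult[OF _ _ S] mark_mem[OF u ab(3) S] mark_mem[OF v cd(3) S])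
qed

lemma mark_mult:
  assumes u: "u \<in> carrier (burnside_ring G X)" and v: "v \<in> carrier (burnside_ring G X)"
    and S: "transitive_gset G S" "e \<in> gmaps G S X"
  shows "mark G S e (u \<otimes>\<^bsub>burnside_ring G X\<^esub> v) = mark G S e u * mark G S e v"
proof -
  obtain a b c d where ab: "a \<in> carrier (over_semiring G X)" "b \<in> carrier (over_semiring G X)" "(a, b) \<in> u"
    and cd: "c \<in> carrier (over_semiring G X)" "d \<in> carrier (over_semiring G X)" "(c, d) \<in> v"
    using u v by (meson burnside_carrierE)
  show ?thesis
    using ab cd
    by (simp add: burnside_mult[OF u v ab(3) cd(3)] mark_fdiff[OF _ _ S] over_semiring_closed
        ccnt_add_mult[OF _ _ S] mark_mem[OF u ab(3) S] mark_mem[OF v cd(3) S] algebra_simps)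
qed

lemma mark_zero:
  assumes S: "transitive_gset G S" "e \<in> gmaps G S X"
  shows "mark G S e \<zero>\<^bsub>burnside_ring G X\<^esub> = 0"
  using mark_fdiff[OF over_semiring_zero(1) over_semiring_zero(1) S]
  by (simp add: burnside_ring_def groth_ring_def)

lemma mark_burnside_class:
  assumes U: "is_over G X U" and S: "transitive_gset G S" "e \<in> gmaps G S X"
  shows "mark G S e (burnside_class G X U) = int (cnt G S e U)"
  unfolding burnside_class_def
  by (simp add: mark_fdiff[OF iso_class_carrier[OF U] over_semiring_zero(1) S]
      over_semiring_zero(2)[OF S] ccnt_iso_class[OF U S])

lemma burnside_class_carrier:
  "is_over G X U \<Longrightarrow> burnside_class G X U \<in> carrier (burnside_ring G X)"
  unfolding burnside_class_def by (rule fdiff_carrier[OF iso_class_carrier over_semiring_zero(1)])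

lemma mark_one:
  assumes X: "finite_gset G X" and S: "transitive_gset G S" "e \<in> gmaps G S X"
  shows "mark G S e \<one>\<^bsub>burnside_ring G X\<^esub> = 1"
proof -
  have "\<one>\<^bsub>burnside_ring G X\<^esub> = burnside_class G X (X, \<lambda>x\<in>pts X. x)"
    by (simp add: burnside_ring_def groth_ring_def burnside_class_def over_semiring_def)
  then show ?thesis
    using mark_burnside_class[OF is_over_id[OF X] S] cnt_over_id[OF S(2)] by simp
qed

text \<open>The common form of restriction and transfer: an operation \<open>F\<close> whose counts
  are sums, over an index set depending on \<open>S\<close> and \<open>e\<close>, of counts of its
  argument. Such a formula is linear in the counts, so it passes to formal differences.\<close>

lemma mark_groth_map:
  assumes u: "u \<in> carrier (burnside_ring G Y)"
    and F: "\<And>U :: ('a, nat) over. is_over G Y U \<Longrightarrow> is_over G X (F U :: ('a, 'x) over)"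
    and t: "\<And>S e i. transitive_gset G S \<Longrightarrow> e \<in> gmaps G S X \<Longrightarrow> i \<in> I S e \<Longrightarrow> t S e i \<in> gmaps G S Y"
    and cnt: "\<And>S e U. transitive_gset G S \<Longrightarrow> e \<in> gmaps G S X \<Longrightarrow> is_over G Y U \<Longrightarrow>
      cnt G S e (F U) = (\<Sum>i\<in>I S e. cnt G S (t S e i) U)"
  defines "h \<equiv> \<lambda>c. \<Union>U\<in>c. iso_class G X (F U)"
  shows "groth_map (over_semiring G X) h u \<in> carrier (burnside_ring G X)"
    and "transitive_gset G S \<Longrightarrow> e \<in> gmaps G S X \<Longrightarrow>
      mark G S e (groth_map (over_semiring G X) h u) = (\<Sum>i\<in>I S e. mark G S (t S e i) u)"
proof -
  have h: "h c \<in> carrier (over_semiring G X) \<and> (\<forall>S e. transitive_gset G S \<longrightarrow> e \<in> gmaps G S X \<longrightarrow>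
      ccnt G S e (h c) = (\<Sum>i\<in>I S e. ccnt G S (t S e i) c))"
    if c: "c \<in> carrier (over_semiring G Y)" for c
  proof -
    obtain U :: "('a, nat) over" where U: "is_over G Y U" "U \<in> c" using carrier_over_semiringE[OF c] by blast
    have cntF: "cnt G S e (F W) = (\<Sum>i\<in>I S e. ccnt G S (t S e i) c)"
      if S: "transitive_gset G S" "e \<in> gmaps G S X" and W: "W \<in> c" for S e W
      unfolding cnt[OF S is_over_mem[OF c W]]
      by (rule sum.cong) (simp_all add: ccnt_mem[OF c W S(1) t[OF S]])
    have "iso_class G X (F W) = iso_class G X (F U)" if "W \<in> c" for W
      using cntF[OF _ _ that] cntF[OF _ _ U(2)]
      by (intro iso_class_eqI F[OF U(1)] F[OF is_over_mem[OF c that]]) simp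
    then have "h c = iso_class G X (F U)" unfolding h_def by (rule UN_eqI[OF U(2)])
    then show ?thesis
      using F[OF U(1)] U(2) by (simp add: iso_class_carrier ccnt_iso_class cntF)
  qed
  \<comment> \<open>The right-hand side mentions only \<open>u\<close>, not the pair representing
    it; this yields well-definedness and the mark formula at once.\<close>
  have m: "int (ccnt G S e (h c)) - int (ccnt G S e (h d)) = (\<Sum>i\<in>I S e. mark G S (t S e i) u)"
    if "(c, d) \<in> u" and S: "transitive_gset G S" "e \<in> gmaps G S X" for S e c d
    using h mem_burnside[OF u that(1)] S t[OF S]
    by (simp add: mark_mem[OF u that(1) S(1)] sum_subtractf)
  obtain c d where cd: "c \<in> carrier (over_semiring G Y)" "d \<in> carrier (over_semiring G Y)" "(c, d) \<in> u"
    using u by (meson burnside_carrierE)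
  have "fdiff (over_semiring G X) (h c') (h d') = fdiff (over_semiring G X) (h c) (h d)"
    if "(c', d') \<in> u" for c' d'
    using h mem_burnside[OF u that] cd m[OF that] m[OF cd(3)] by (intro fdiff_eqI) auto
  then have eq: "groth_map (over_semiring G X) h u = fdiff (over_semiring G X) (h c) (h d)"
    unfolding groth_map_def by (rule UN_pair_eqI[OF cd(3)])
  show "groth_map (over_semiring G X) h u \<in> carrier (burnside_ring G X)"
    unfolding eq using h cd by (intro fdiff_carrier) auto
  show "mark G S e (groth_map (over_semiring G X) h u) = (\<Sum>i\<in>I S e. mark G S (t S e i) u)"
    if "transitive_gset G S" "e \<in> gmaps G S X"
    unfolding eq mark_fdiff[OF conjunct1[OF h[OF cd(1)]] conjunct1[OF h[OF cd(2)]] that]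
    by (rule m[OF cd(3) that])
qed

lemma mark_burnside_res:
  assumes X: "finite_gset G X" and f: "f \<in> gmaps G X Y"
    and u: "u \<in> carrier (burnside_ring G Y)" and S: "transitive_gset G S" "e \<in> gmaps G S X"
  shows "mark G S e (burnside_res G X Y f u) = mark G S (compose (pts S) f e) u"
proof -
  \<comment> \<open>Pull-back involves a single count, so the index set is the singleton
    \<open>{()}\<close>.\<close>
  have "mark G S e (groth_map (over_semiring G X) (\<lambda>c. \<Union>U\<in>c. iso_class G X (over_pull X f U)) u) =
      (\<Sum>i\<in>{()}. mark G S (compose (pts S) f e) u)"
    by (rule mark_groth_map(2)[OF u, where F = "over_pull X f" and I = "\<lambda>S e. {()}" and t = "\<lambda>S e i. compose (pts S) f e"])
      (simp_all add: is_over_pull[OF X f] gmaps_compose[OF transitive_gsetD(1) _ f]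
        cnt_over_pull[OF transitive_gsetD(1)] S)
  then show ?thesis by (simp add: burnside_res_def)
qed

lemma mark_burnside_tr:
  assumes X: "finite_gset G X" and f: "f \<in> gmaps G X Y"
    and u: "u \<in> carrier (burnside_ring G X)" and S: "transitive_gset G S" "e \<in> gmaps G S Y"
  shows "mark G S e (burnside_tr G X Y f u) = (\<Sum>e'\<in>lifts G S e (X, f). mark G S e' u)"
  unfolding burnside_tr_def
  by (rule mark_groth_map(2)[OF u, where F = "over_push f" and I = "\<lambda>S e. lifts G S e (X, f)" and t = "\<lambda>S e i. i"])
    (simp_all add: is_over_push[OF f] cnt_over_push[OF transitive_gsetD(1) X] lifts_def S)

end

section \<open>Norms to the point\<close>

text \<open>Building an exponential diagram out of models takes equivariant maps both from a
  construction to its model and back.\<close>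

lemma (in group) nat_model_inverse:
  assumes X: "finite_gset G X"
  obtains Y :: "'a obj" and h k where "finite_gset G Y" "h \<in> gmaps G X Y" "k \<in> gmaps G Y X"
    "\<And>x. x \<in> pts X \<Longrightarrow> k (h x) = x" "\<And>y. y \<in> pts Y \<Longrightarrow> h (k y) = y"
proof -
  obtain Y :: "'a obj" and h where Y: "finite_gset G Y" and h: "h \<in> gmaps G X Y"
    and bij: "bij_betw h (pts X) (pts Y)"
    by (rule nat_model[OF X])
  show ?thesis
  proof (rule that[OF Y h gmaps_inv_into[OF X h bij Y]])
    show "restrict (inv_into (pts X) h) (pts Y) (h x) = x" if "x \<in> pts X" for x
      using that bij gmaps_in[OF h that] by (simp add: bij_betw_inv_into_left)
    show "h (restrict (inv_into (pts X) h) (pts Y) y) = y" if "y \<in> pts Y" for y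
      using that bij by (simp add: bij_betw_inv_into_right)
  qed
qed

locale burnside_on_group = group G + burnside_tambara_functor G T
  for G (structure) and T
begin

sublocale plus: mackey_functor G "\<lambda>X. add_monoid (tval T X)" "tres T" "ttr T"
  by (rule additive)

sublocale times: semi_mackey_functor G "tval T" "tres T" "tnm T"
  by (rule multiplicative)

abbreviation pt :: "'a obj" where "pt \<equiv> point_gset"

lemmas finite_pt = transitive_gsetD(1)[OF transitive_point]

lemma point_id: "(\<lambda>x\<in>{0}. x) \<in> gmaps G pt pt"
  using gmaps_id[OF finite_pt] by (simp add: point_gset_def)

lemma res_closed:
  "\<lbrakk>finite_gset G X; finite_gset G Y; f \<in> gmaps G X Y; a \<in> carrier (tval T Y)\<rbrakk>
    \<Longrightarrow> tres T X Y f a \<in> carrier (tval T X)"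
  using times.con_closed by blast

lemma tr_closed:
  "\<lbrakk>finite_gset G X; finite_gset G Y; f \<in> gmaps G X Y; a \<in> carrier (tval T X)\<rbrakk>
    \<Longrightarrow> ttr T X Y f a \<in> carrier (tval T Y)"
  using plus.cov_closed[of X Y f] by (simp add: Pi_iff)

lemma nm_closed:
  "\<lbrakk>finite_gset G X; finite_gset G Y; f \<in> gmaps G X Y; a \<in> carrier (tval T X)\<rbrakk>
    \<Longrightarrow> tnm T X Y f a \<in> carrier (tval T Y)"
  using times.cov_closed by blast

lemma mark_res:
  assumes "finite_gset G X" "finite_gset G Y" "f \<in> gmaps G X Y" "a \<in> carrier (tval T Y)"
    and "transitive_gset G S" "e \<in> gmaps G S X"
  shows "mark G S e (tres T X Y f a) = mark G S (compose (pts S) f e) a"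
  using assms by (simp add: val_burnside res_burnside mark_burnside_res)

lemma mark_tr:
  assumes "finite_gset G X" "finite_gset G Y" "f \<in> gmaps G X Y" "a \<in> carrier (tval T X)"
    and "transitive_gset G S" "e \<in> gmaps G S Y"
  shows "mark G S e (ttr T X Y f a) = (\<Sum>e'\<in>lifts G S e (X, f). mark G S e' a)"
  using assms by (simp add: val_burnside tr_burnside mark_burnside_tr)

text \<open>On actual G-sets this counts the fixed points of the dependent product along the map
  from \<open>S\<close> to the point. It extracts from the abstract norm an integer that can be
  controlled on virtual G-sets as well.\<close>

definition norm_mark :: "'a obj \<Rightarrow> 'a burnside_elt \<Rightarrow> int" where
  "norm_mark S u = mark G pt (\<lambda>x\<in>{0}. x) (tnm T S pt (to_point S) u)"

text \<open>The exponential diagram turns the transfer along \<open>p\<close> into a sum over the fixed points of the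
  dependent product, and base change along such a fixed point identifies its contribution.\<close>

lemma norm_mark_tr:
  assumes S: "finite_gset G S" and A: "finite_gset G A" and p: "p \<in> gmaps G A S"
    and a: "a \<in> carrier (tval T A)"
  shows "norm_mark S (ttr T A S p a) =
    (\<Sum>s\<in>lifts G S (\<lambda>x\<in>pts S. x) (A, p). norm_mark S (tres T S A s a))"
proof -
  let ?f = "to_point S"
  let ?D = "dprod_gset G S pt ?f A p"
  let ?Dp = "dprod_pts S pt ?f A p"
  let ?F = "fibprod_gset S ?f ?D fst"
  let ?Fp = "fibprod_pts S ?f ?D fst"
  have f: "?f \<in> gmaps G S pt" by (rule to_point[OF S])
  have fx: "?f x = 0" if "x \<in> pts S" for x using that by (simp add: to_point_def)
  have D: "finite_gset G ?D" by (rule finite_gset_dprod[OF S finite_pt A f p])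
  have ptsD: "pts ?D = ?Dp" by (simp add: dprod_gset_def)
  have fstD: "fst w = 0" if "w \<in> ?Dp" for w using that by (auto simp: dprod_pts_def point_gset_def)
  have fst_map: "restrict fst ?Dp \<in> gmaps G ?D pt"
    unfolding ptsD[symmetric]
    by (rule gmaps_restrictI[OF D]) (auto simp: dprod_gset_def dprod_pts_def)
  \<comment> \<open>Exponential diagrams are stated with the bare projection \<open>fst\<close>,
    while equivariant maps are extensional. Only values on \<open>?Dp\<close> enter, so both give
    the same fibre product.\<close>
  have "?F = fibprod_gset S ?f ?D (restrict fst ?Dp)"
    by (auto simp: fibprod_gset_def fibprod_pts_def ptsD fun_eq_iff)
  then have F: "finite_gset G ?F" using finite_gset_fibprod[OF S D f fst_map] by simp
  have ptsF: "pts ?F = ?Fp" by (simp add: fibprod_gset_def)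
  have Fp: "?Fp = pts S \<times> ?Dp"
    unfolding fibprod_pts_def ptsD using fstD by (auto simp: fx)
  have actF: "act ?F g (x, w) = (act S g x, act ?D g w)" if "x \<in> pts S" "w \<in> ?Dp" for g x w
    using that by (simp add: fibprod_gset_def Fp)
  obtain P :: "'a obj" and hP th where P: "finite_gset G P" and hP: "hP \<in> gmaps G ?D P"
    and th: "th \<in> gmaps G P ?D"
    and th_hP: "\<And>w. w \<in> pts ?D \<Longrightarrow> th (hP w) = w" and hP_th: "\<And>v. v \<in> pts P \<Longrightarrow> hP (th v) = v"
    using nat_model_inverse[OF D] by blast
  obtain Z :: "'a obj" and hZ ze where Z: "finite_gset G Z" and hZ: "hZ \<in> gmaps G ?F Z"
    and ze: "ze \<in> gmaps G Z ?F"
    and ze_hZ: "\<And>w. w \<in> pts ?F \<Longrightarrow> ze (hZ w) = w" and hZ_ze: "\<And>v. v \<in> pts Z \<Longrightarrow> hZ (ze v) = v"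
    using nat_model_inverse[OF F] by blast
  have th_bij: "bij_betw th (pts P) ?Dp"
    using gmaps_in[OF hP] gmaps_in[OF th] th_hP hP_th
    by (intro bij_betwI[where g = hP]) (auto simp: ptsD)
  have ze_bij: "bij_betw ze (pts Z) ?Fp"
    using gmaps_in[OF hZ] gmaps_in[OF ze] ze_hZ hZ_ze
    by (intro bij_betwI[where g = hZ]) (auto simp: ptsF)
  have thD: "th v \<in> ?Dp" if "v \<in> pts P" for v using gmaps_in[OF th that] by (simp add: ptsD)
  have zeF: "fst (ze v) \<in> pts S" "snd (ze v) \<in> ?Dp" if "v \<in> pts Z" for v
    using gmaps_in[OF ze that] by (auto simp: ptsF Fp)
  define q where "q = (\<lambda>w\<in>pts P. fst (th w))"
  define r where "r = (\<lambda>z\<in>pts Z. hP (snd (ze z)))"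
  define l where "l = (\<lambda>z\<in>pts Z. snd (snd (ze z)) (fst (ze z)))"
  have q: "q \<in> gmaps G P pt"
  proof -
    have "q = compose (pts P) (restrict fst ?Dp) th"
      by (auto simp: q_def compose_def thD fun_eq_iff)
    then show ?thesis using gmaps_compose[OF P th fst_map] by simp
  qed
  have ze_act: "ze (act Z g z) = (act S g (fst (ze z)), act ?D g (snd (ze z)))"
    if g: "g \<in> carrier G" and z: "z \<in> pts Z" for g z
    using gmaps_act[OF ze g z] actF[OF zeF[OF z], of g] by simp
  have r: "r \<in> gmaps G Z P"
    unfolding r_def
  proof (rule gmaps_restrictI[OF Z])
    show "hP (snd (ze z)) \<in> pts P" if "z \<in> pts Z" for z
      using gmaps_in[OF hP] zeF(2)[OF that] by (simp add: ptsD)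
    show "hP (snd (ze (act Z g z))) = act P g (hP (snd (ze z)))" if "g \<in> carrier G" "z \<in> pts Z" for g z
      using ze_act[OF that] gmaps_act[OF hP that(1)] zeF(2)[OF that(2)] by (simp add: ptsD)
  qed
  have sec: "s x \<in> pts A" if "(y, s) \<in> ?Dp" "x \<in> pts S" for y s x
    using that fstD[OF that(1)] by (auto simp: dprod_pts_def fiber_def fx)
  have D_eval: "snd (act ?D g w) (act S g x) = act A g (snd w x)"
    if g: "g \<in> carrier G" and x: "x \<in> pts S" and w: "w \<in> ?Dp" for g x w
  proof -
    obtain y s where ys: "w = (y, s)" by force
    have "act pt g y = 0" using fstD[OF w] ys by (simp add: point_gset_def)
    moreover have "act ?D g w = (act pt g y,
        \<lambda>x\<in>fiber S ?f (act pt g y). act A g (s (act S (inv g) x)))"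
      using w unfolding ys by (simp only: dprod_gset_def gset.simps restrict_apply' prod.case)
    ultimately show ?thesis
      using S g x by (simp add: ys fiber_def fx act_closed act_inv)
  qed
  have l: "l \<in> gmaps G Z A"
    unfolding l_def
  proof (rule gmaps_restrictI[OF Z])
    show "snd (snd (ze z)) (fst (ze z)) \<in> pts A" if "z \<in> pts Z" for z
      using sec[of "fst (snd (ze z))" "snd (snd (ze z))"] zeF[OF that] by simp
    show "snd (snd (ze (act Z g z))) (fst (ze (act Z g z))) = act A g (snd (snd (ze z)) (fst (ze z)))"
      if "g \<in> carrier G" "z \<in> pts Z" for g z
      using ze_act[OF that] D_eval[OF that(1) zeF[OF that(2)]] by simp
  qed
  have th_r: "th (r z) = snd (ze z)" if "z \<in> pts Z" for z
    using th_hP zeF(2)[OF that] that by (simp add: r_def ptsD)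
  have "is_exponential G S pt A ?f p P Z q r l"
    unfolding is_exponential_def
  proof (intro conjI)
    show "\<exists>th\<in>gmaps G P ?D. \<exists>ze\<in>gmaps G Z ?F.
        bij_betw th (pts P) ?Dp \<and> bij_betw ze (pts Z) ?Fp \<and> (\<forall>w\<in>pts P. q w = fst (th w)) \<and>
        (\<forall>z\<in>pts Z. case ze z of (x, y, s) \<Rightarrow> th (r z) = (y, s) \<and> l z = s x)"
      using th ze th_bij ze_bij th_r
      by (intro bexI[of _ th] bexI[of _ ze]) (auto simp: q_def l_def split: prod.splits)
  qed (use S A P Z f p q r l finite_pt in auto)
  from exponential[OF this a]
  have eq: "tnm T S pt ?f (ttr T A S p a) = ttr T P pt q (tnm T Z P r (tres T Z A l a))" .
  let ?z = "tres T Z A l a"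
  let ?w = "tnm T Z P r ?z"
  have zc: "?z \<in> carrier (tval T Z)" by (rule res_closed[OF Z A l a])
  have wc: "?w \<in> carrier (tval T P)" by (rule nm_closed[OF Z P r zc])
  have contrib: "mark G pt e ?w = norm_mark S (tres T S A (snd (th (e 0))) a)"
    if e: "e \<in> lifts G pt (\<lambda>x\<in>{0}. x) (P, q)" for e
  proof -
    have eP: "e \<in> gmaps G pt P" using e by (simp add: lifts_def)
    have e0: "e 0 \<in> pts P" using gmaps_in[OF eP, of 0] by (simp add: point_gset_def)
    have e0_fix: "act P g (e 0) = e 0" if "g \<in> carrier G" for g
      using gmaps_act[OF eP that, of 0] by (simp add: point_gset_def)
    let ?fp = "th (e 0)"
    have w0: "?fp \<in> ?Dp" by (rule thD[OF e0])
    have w0_fix: "act ?D g ?fp = ?fp" if "g \<in> carrier G" for g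
      using gmaps_act[OF th that e0] e0_fix[OF that] by simp
    \<comment> \<open>Since \<open>?fp\<close> is fixed by the action, the slice of
      \<open>S \<times> ?Dp\<close> at \<open>?fp\<close> is invariant; \<open>d\<close> embeds
      \<open>S\<close> into \<open>Z\<close> as this slice.\<close>
    define d where "d = (\<lambda>x\<in>pts S. hZ (x, ?fp))"
    have ze_d: "ze (d x) = (x, ?fp)" if "x \<in> pts S" for x
      using that w0 ze_hZ by (simp add: d_def ptsF Fp)
    have d: "d \<in> gmaps G S Z"
      unfolding d_def
    proof (rule gmaps_restrictI[OF S])
      show "hZ (x, ?fp) \<in> pts Z" if "x \<in> pts S" for x
        using gmaps_in[OF hZ] that w0 by (simp add: ptsF Fp)
      show "hZ (act S g x, ?fp) = act Z g (hZ (x, ?fp))" if "g \<in> carrier G" "x \<in> pts S" for g x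
        using gmaps_act[OF hZ that(1), of "(x, ?fp)"] that w0 actF w0_fix by (simp add: ptsF Fp)
    qed
    have r_iff: "r z = e 0 \<longleftrightarrow> snd (ze z) = ?fp" if z: "z \<in> pts Z" for z
      using th_r[OF z] hP_th[OF e0] hP_th[OF gmaps_in[OF r z]] by metis
    \<comment> \<open>The fibre of \<open>r\<close> over the point picked by \<open>e\<close> is
      exactly this slice, so base change replaces the norm along \<open>r\<close>, restricted along
      \<open>e\<close>, by a norm from \<open>S\<close> to the point.\<close>
    have "is_pullback G Z P S pt r e d ?f"
      unfolding is_pullback_def
    proof (intro conjI)
      show "bij_betw (\<lambda>t. (d t, ?f t)) (pts S) (fibprod_pts Z r pt e)"
      proof (rule bij_betwI[where g = "\<lambda>(z, _). fst (ze z)"])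
        show "(\<lambda>t. (d t, ?f t)) \<in> pts S \<rightarrow> fibprod_pts Z r pt e"
          using gmaps_in[OF d] r_iff ze_d
          by (auto simp: fibprod_pts_def fx point_gset_def)
        show "(\<lambda>(z, _). fst (ze z)) \<in> fibprod_pts Z r pt e \<rightarrow> pts S"
          using zeF(1) by (auto simp: fibprod_pts_def)
        show "(case (d t, ?f t) of (z, _) \<Rightarrow> fst (ze z)) = t" if "t \<in> pts S" for t
          using ze_d[OF that] by simp
        show "(d (case v of (z, _) \<Rightarrow> fst (ze z)), ?f (case v of (z, _) \<Rightarrow> fst (ze z))) = v"
          if v: "v \<in> fibprod_pts Z r pt e" for v
        proof -
          obtain z where z: "v = (z, 0)" "z \<in> pts Z" "r z = e 0"
            using v by (auto simp: fibprod_pts_def point_gset_def)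
          have "ze z = (fst (ze z), ?fp)" using r_iff[OF z(2)] z(3) by (simp add: prod_eq_iff)
          then have "d (fst (ze z)) = z"
            using zeF(1)[OF z(2)] hZ_ze[OF z(2)] by (metis d_def restrict_apply')
          then show ?thesis using z(1) fx zeF(1)[OF z(2)] by simp
        qed
      qed
    qed (use S P Z finite_pt r eP d f in auto)
    from times.base_change[OF this zc]
    have bc: "tres T pt P e ?w = tnm T S pt ?f (tres T S Z d ?z)" .
    have "snd ?fp \<in> extensional (pts S)"
      using w0 fstD[OF w0] fx by (auto simp: dprod_pts_def fiber_def PiE_def extensional_def)
    \<comment> \<open>The map \<open>l\<close> is evaluation of sections, so on the slice it is the
      section itself.\<close>
    then have ld: "compose (pts S) l d = snd ?fp"
      using gmaps_in[OF d] ze_d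
      by (intro extensionalityI[of _ "pts S"]) (auto simp: compose_eq l_def)
    have "tres T S Z d ?z = tres T S A (snd ?fp) a"
      using times.con_comp[OF S Z A d l a] ld by simp
    moreover have "compose (pts pt) e (\<lambda>x\<in>{0}. x) = e"
      using gmaps_ext[OF eP] by (auto simp: compose_def extensional_def point_gset_def fun_eq_iff)
    ultimately show ?thesis
      using mark_res[OF finite_pt P eP wc transitive_point point_id] bc
      by (simp add: norm_mark_def)
  qed
  have "norm_mark S (ttr T A S p a) = (\<Sum>e\<in>lifts G pt (\<lambda>x\<in>{0}. x) (P, q). mark G pt e ?w)"
    unfolding norm_mark_def eq by (rule mark_tr[OF P finite_pt q wc transitive_point point_id])
  also have "\<dots> = (\<Sum>e\<in>lifts G pt (\<lambda>x\<in>{0}. x) (P, q). norm_mark S (tres T S A (snd (th (e 0))) a))"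
    by (rule sum.cong[OF refl contrib])
  also have "\<dots> = (\<Sum>s\<in>lifts G S (\<lambda>x\<in>pts S. x) (A, p). norm_mark S (tres T S A s a))"
    by (rule sum.reindex_bij_betw[OF bij_betw_fixed_points_sections[OF S A p P th th_bij]])
      (simp add: q_def)
  finally show ?thesis .
qed

text \<open>The sum \<open>u + v\<close> is the transfer along the folding map of an element over
  \<open>S + S\<close> with components \<open>u\<close> and \<open>v\<close>, so the formula for
  norms of transfers applies. Its two sections are the inclusions of the summands, and restriction
  along them returns \<open>u\<close> and \<open>v\<close>.\<close>

lemma norm_mark_add:
  assumes S: "transitive_gset G S" and u: "u \<in> carrier (tval T S)" and v: "v \<in> carrier (tval T S)"
  shows "norm_mark S (u \<oplus>\<^bsub>tval T S\<^esub> v) = norm_mark S u + norm_mark S v"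
proof -
  note Sf = transitive_gsetD(1)[OF S]
  let ?C = "sum_gset S S"
  have C: "finite_gset G ?C" by (rule finite_gset_sum[OF Sf Sf])
  have ptsC: "pts ?C = pts S <+> pts S" by (simp add: sum_gset_def)
  obtain W :: "'a obj" and h k where W: "finite_gset G W" and h: "h \<in> gmaps G ?C W"
    and k: "k \<in> gmaps G W ?C"
    and kh: "\<And>w. w \<in> pts ?C \<Longrightarrow> k (h w) = w" and hk: "\<And>v. v \<in> pts W \<Longrightarrow> h (k v) = v"
    using nat_model_inverse[OF C] by blast
  have kh': "k (h (Inl x)) = Inl x" "k (h (Inr x)) = Inr x" if "x \<in> pts S" for x
    using that by (simp_all add: kh ptsC InlI InrI)
  define i where "i = (\<lambda>x\<in>pts S. h (Inl x))"
  define j where "j = (\<lambda>x\<in>pts S. h (Inr x))"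
  have i: "i \<in> gmaps G S W"
    unfolding i_def
  proof (rule gmaps_restrictI[OF Sf])
    show "h (Inl x) \<in> pts W" if "x \<in> pts S" for x
      using gmaps_in[OF h, of "Inl x"] that by (auto simp: ptsC)
    show "h (Inl (act S g x)) = act W g (h (Inl x))" if "g \<in> carrier G" "x \<in> pts S" for g x
      using gmaps_act[OF h that(1), of "Inl x"] that by (auto simp: sum_gset_def)
  qed
  have j: "j \<in> gmaps G S W"
    unfolding j_def
  proof (rule gmaps_restrictI[OF Sf])
    show "h (Inr x) \<in> pts W" if "x \<in> pts S" for x
      using gmaps_in[OF h, of "Inr x"] that by (auto simp: ptsC)
    show "h (Inr (act S g x)) = act W g (h (Inr x))" if "g \<in> carrier G" "x \<in> pts S" for g x
      using gmaps_act[OF h that(1), of "Inr x"] that by (auto simp: sum_gset_def)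
  qed
  define n where "n = (\<lambda>w\<in>pts W. case_sum (\<lambda>x. x) (\<lambda>x. x) (k w))"
  have kW: "k w \<in> pts S <+> pts S" if "w \<in> pts W" for w using gmaps_in[OF k that] by (simp add: ptsC)
  have n: "n \<in> gmaps G W S"
    unfolding n_def
  proof (rule gmaps_restrictI[OF W])
    show "case_sum (\<lambda>x. x) (\<lambda>x. x) (k w) \<in> pts S" if "w \<in> pts W" for w
      using kW[OF that] by auto
    show "case_sum (\<lambda>x. x) (\<lambda>x. x) (k (act W g w)) = act S g (case_sum (\<lambda>x. x) (\<lambda>x. x) (k w))"
      if "g \<in> carrier G" "w \<in> pts W" for g w
      using gmaps_act[OF k that] kW[OF that(2)] by (auto simp: sum_gset_def)
  qed
  have ni: "n (i x) = x" "n (j x) = x" if "x \<in> pts S" for x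
    using kh'[OF that] gmaps_in[OF i that] gmaps_in[OF j that] that
    by (simp_all add: n_def i_def j_def)
  have "bij_betw h (pts S <+> pts S) (pts W)"
    using gmaps_in[OF h] gmaps_in[OF k] kh hk by (intro bij_betwI[where g = k]) (auto simp: ptsC)
  moreover have "bij_betw (case_sum i j) (pts S <+> pts S) (pts W) \<longleftrightarrow>
      bij_betw h (pts S <+> pts S) (pts W)"
    by (rule bij_betw_cong) (auto simp: i_def j_def)
  ultimately have cop: "is_coproduct G S S W i j"
    using Sf W i j by (simp add: is_coproduct_def)
  \<comment> \<open>The contravariant part turns the coproduct into a product, which provides the
    element \<open>z\<close> with the two prescribed restrictions.\<close>
  have "(u, v) \<in> (\<lambda>a. (tres T S W i a, tres T S W j a)) ` carrier (tval T W)"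
    using bij_betw_imp_surj_on[OF plus.con_coproduct[OF cop]] u v by simp
  then obtain z where z: "z \<in> carrier (tval T W)" "tres T S W i z = u" "tres T S W j z = v"
    by auto
  have "u \<oplus>\<^bsub>tval T S\<^esub> v = ttr T W S n z"
    using plus.op_fold[OF cop n ni(1) ni(2), of z] z by simp
  then have "norm_mark S (u \<oplus>\<^bsub>tval T S\<^esub> v) =
      (\<Sum>s\<in>lifts G S (\<lambda>x\<in>pts S. x) (W, n). norm_mark S (tres T S W s z))"
    using norm_mark_tr[OF Sf W n z(1)] by simp
  moreover have "lifts G S (\<lambda>x\<in>pts S. x) (W, n) = {i, j}"
  proof (intro equalityI subsetI)
    fix s assume "s \<in> lifts G S (\<lambda>x\<in>pts S. x) (W, n)"
    then have s: "s \<in> gmaps G S W" "\<And>x. x \<in> pts S \<Longrightarrow> n (s x) = x" by (auto simp: lifts_def)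
    obtain t where t: "t \<in> pts S" using transitive_gsetD(2)[OF S] by auto
    have "s t \<in> pts W" by (rule gmaps_in[OF s(1) t])
    then have "s t = i t \<or> s t = j t"
      using kW[of "s t"] hk[of "s t"] s(2)[OF t] by (auto simp: n_def i_def j_def)
    \<comment> \<open>An equivariant map out of a transitive G-set is determined by one value, so
      agreeing with \<open>i\<close> or \<open>j\<close> at \<open>t\<close> is enough.\<close>
    moreover have "s = s'" if s': "s' \<in> gmaps G S W" "s t = s' t" for s'
    proof (rule gmaps_eqI[OF s(1) s'(1)])
      fix x assume "x \<in> pts S"
      then obtain g where "g \<in> carrier G" "x = act S g t" using transitive_gsetD(3)[OF S t] by blast
      then show "s x = s' x" using gmaps_act[OF s(1) _ t] gmaps_act[OF s'(1) _ t] s'(2) by simp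
    qed
    ultimately show "s \<in> {i, j}" using i j by blast
  qed (use i j ni in \<open>auto simp: lifts_def\<close>)
  moreover have "i \<noteq> j"
  proof
    assume "i = j"
    obtain t where t: "t \<in> pts S" using transitive_gsetD(2)[OF S] by auto
    then have "h (Inl t) = h (Inr t)" using \<open>i = j\<close> by (metis i_def j_def restrict_apply')
    then show False using kh'[OF t] by simp
  qed
  ultimately show ?thesis using z by simp
qed

text \<open>The only use of the prescribed value of the norm on actual G-sets: fixed points of the
  dependent product are equivariant sections, which are the lifts of the identity of
  \<open>S\<close>.\<close>

lemma norm_mark_class:
  assumes S: "finite_gset G S" and U: "is_over G S (U :: ('a, nat) over)"
  shows "norm_mark S (burnside_class G S U) = int (cnt G S (\<lambda>x\<in>pts S. x) U)"
  unfolding norm_mark_def nm_burnside[OF S finite_pt to_point[OF S] U]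
    mark_burnside_class[OF is_over_dprod[OF S finite_pt to_point[OF S] U] transitive_point point_id]
    cnt_over_dprod_point[OF S U] ..

text \<open>For \<open>u\<close> the difference of the classes of \<open>U\<close> and
  \<open>W\<close>, moving \<open>W\<close> to the other side leaves an equation between sums;
  additivity then gives the value at \<open>u\<close> from those at the two classes. The norm of a
  negative element is never computed.\<close>

lemma norm_mark_eq:
  assumes S: "transitive_gset G S" and u: "u \<in> carrier (tval T S)"
  shows "norm_mark S u = mark G S (\<lambda>x\<in>pts S. x) u"
proof -
  note Sf = transitive_gsetD(1)[OF S]
  have val: "tval T S = burnside_ring G S" by (rule val_burnside[OF Sf])
  obtain c d where c: "c \<in> carrier (over_semiring G S)" and d: "d \<in> carrier (over_semiring G S)"
    and cd: "(c, d) \<in> u"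
    using u unfolding val by (rule burnside_carrierE)
  obtain U W :: "('a, nat) over" where U: "is_over G S U" "U \<in> c" and W: "is_over G S W" "W \<in> d"
    using carrier_over_semiringE[OF c] carrier_over_semiringE[OF d] by metis
  let ?U = "burnside_class G S U" and ?W = "burnside_class G S W"
  have Uc: "?U \<in> carrier (tval T S)" and Wc: "?W \<in> carrier (tval T S)"
    using U W by (auto simp: val burnside_class_carrier)
  have mk: "mark G S' e u = int (cnt G S' e U) - int (cnt G S' e W)"
    if S': "transitive_gset G S'" "e \<in> gmaps G S' S" for S' :: "'a obj" and e
    using mark_mem[OF u[unfolded val] cd S'] ccnt_mem[OF c U(2) S'] ccnt_mem[OF d W(2) S'] by simp
  have "u \<oplus>\<^bsub>tval T S\<^esub> ?W = ?U"
  proof (rule mark_ext)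
    show "u \<oplus>\<^bsub>tval T S\<^esub> ?W \<in> carrier (burnside_ring G S)"
      using cring_val[OF Sf] u Wc by (metis cring.cring_simprules(1) val)
    show "?U \<in> carrier (burnside_ring G S)" using Uc val by simp
    fix S' :: "'a obj" and e assume S': "transitive_gset G S'" "e \<in> gmaps G S' S"
    show "mark G S' e (u \<oplus>\<^bsub>tval T S\<^esub> ?W) = mark G S' e ?U"
      using mark_add[OF u[unfolded val] Wc[unfolded val] S'] mk[OF S']
        mark_burnside_class[OF U(1) S'] mark_burnside_class[OF W(1) S'] by (simp add: val)
  qed
  then have "norm_mark S u + norm_mark S ?W = norm_mark S ?U"
    using norm_mark_add[OF S u Wc] by simp
  then show ?thesis
    using mk[OF S gmaps_id[OF Sf]] norm_mark_class[OF Sf U(1)] norm_mark_class[OF Sf W(1)] by simp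
qed

section \<open>Elements of generated ideals over the point, and primality of zero\<close>

lemma gen_ideal_witness:
  assumes X: "finite_gset G X" and a: "a \<in> carrier (tval T X)" "a \<noteq> \<zero>\<^bsub>tval T X\<^esub>"
  obtains v where "v \<in> gen_ideal G T X a pt" "v \<in> carrier (tval T pt)" "mark G pt (\<lambda>x\<in>{0}. x) v \<noteq> 0"
proof -
  have val: "tval T X = burnside_ring G X" by (rule val_burnside[OF X])
  have "\<zero>\<^bsub>tval T X\<^esub> \<in> carrier (tval T X)" using cring_val[OF X] by (rule cring.cring_simprules(2))
  then have "\<exists>S e. transitive_gset G S \<and> e \<in> gmaps G S X \<and> mark G S e a \<noteq> mark G S e \<zero>\<^bsub>tval T X\<^esub>"
    using a mark_ext[of a X "\<zero>\<^bsub>tval T X\<^esub>"] unfolding val by blast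
  then obtain S :: "'a obj" and e where S: "transitive_gset G S" and e: "e \<in> gmaps G S X"
    and ne: "mark G S e a \<noteq> 0"
    using mark_zero[where X = X] unfolding val by metis
  note Sf = transitive_gsetD(1)[OF S]
  let ?x = "tres T S X e a"
  let ?n = "tnm T S pt (to_point S)"
  have x: "?x \<in> carrier (tval T S)" by (rule res_closed[OF Sf X e a(1)])
  have z: "\<zero>\<^bsub>tval T S\<^esub> \<in> carrier (tval T S)" using cring_val[OF Sf] by (rule cring.cring_simprules(2))
  \<comment> \<open>The mark of \<open>?x\<close> at the identity of \<open>S\<close> is the mark of
    \<open>a\<close> at \<open>e\<close>, which is nonzero.\<close>
  have "compose (pts S) e (\<lambda>x\<in>pts S. x) = e"
    using gmaps_ext[OF e] by (auto simp: compose_def extensional_def fun_eq_iff)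
  then have "norm_mark S ?x \<noteq> 0"
    using norm_mark_eq[OF S x] mark_res[OF Sf X e a(1) S gmaps_id[OF Sf]] ne by simp
  moreover have "norm_mark S \<zero>\<^bsub>tval T S\<^esub> = 0"
    using norm_mark_eq[OF S z] mark_zero[OF S gmaps_id[OF Sf]] by (simp add: val_burnside[OF Sf])
  moreover interpret R: cring "tval T pt" by (rule cring_val[OF finite_pt])
  have nx: "?n ?x \<in> carrier (tval T pt)" and nz: "?n \<zero>\<^bsub>tval T S\<^esub> \<in> carrier (tval T pt)"
    using nm_closed[OF Sf finite_pt to_point[OF Sf]] x z by auto
  \<comment> \<open>An ideal controls norms only up to the norm of zero, so the latter is
    subtracted. This leaves the mark unchanged, since the norm of zero has mark 0 at the
    point.\<close>
  define v where "v = ?n ?x \<ominus>\<^bsub>tval T pt\<^esub> ?n \<zero>\<^bsub>tval T S\<^esub>"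
  have v: "v \<in> carrier (tval T pt)" using nx nz by (simp add: v_def)
  have "?n ?x = v \<oplus>\<^bsub>tval T pt\<^esub> ?n \<zero>\<^bsub>tval T S\<^esub>"
    using nx nz by (simp add: v_def R.minus_eq R.a_assoc R.l_neg)
  then have "norm_mark S ?x = mark G pt (\<lambda>x\<in>{0}. x) v + norm_mark S \<zero>\<^bsub>tval T S\<^esub>"
    unfolding norm_mark_def
    using mark_add[OF v[unfolded val_burnside[OF finite_pt]] nz[unfolded val_burnside[OF finite_pt]]
        transitive_point point_id] by (simp add: val_burnside[OF finite_pt])
  ultimately have "mark G pt (\<lambda>x\<in>{0}. x) v \<noteq> 0" by simp
  moreover have "v \<in> I pt" if I: "tambara_ideal G T I" "a \<in> I X" for I
  proof -
    have xI: "?x \<in> I S" using I Sf X e unfolding tambara_ideal_def by blast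
    have "tnm T S pt (to_point S) ` I S \<subseteq> ?n \<zero>\<^bsub>tval T S\<^esub> <+\<^bsub>tval T pt\<^esub> I pt"
      using I(1) Sf finite_pt to_point[OF Sf] unfolding tambara_ideal_def by blast
    with xI have "?n ?x \<in> ?n \<zero>\<^bsub>tval T S\<^esub> <+\<^bsub>tval T pt\<^esub> I pt" by blast
    then obtain y where y: "y \<in> I pt" "?n ?x = ?n \<zero>\<^bsub>tval T S\<^esub> \<oplus>\<^bsub>tval T pt\<^esub> y"
      by (auto simp: a_l_coset_def')
    have "ideal (I pt) (tval T pt)" using I(1) finite_pt unfolding tambara_ideal_def by blast
    then have "y \<in> carrier (tval T pt)" using y(1) by (rule ideal.Icarr)
    \<comment> \<open>Subtracting the coset representative leaves the member \<open>y\<close> of the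
      ideal, so \<open>v\<close> belongs to every ideal containing \<open>a\<close>.\<close>
    then have "v = y"
      using nz unfolding v_def y(2) by (simp add: R.minus_eq R.a_comm[OF nz] R.a_assoc R.r_neg)
    then show ?thesis using y(1) by simp
  qed
  then have "v \<in> gen_ideal G T X a pt" by (auto simp: gen_ideal_def)
  ultimately show ?thesis using that v by blast
qed

text \<open>For restriction and transfer, all marks of the image of zero are marks of zero or sums
  of such. The norm condition is tautological here: the norm of zero lies in its own coset.\<close>

lemma tambara_ideal_zero: "tambara_ideal G T (\<lambda>X. {\<zero>\<^bsub>tval T X\<^esub>})"
  unfolding tambara_ideal_def
proof (intro conjI allI impI)
  fix X :: "'a obj" assume X: "finite_gset G X"
  then interpret X: cring "tval T X" by (rule cring_val)
  show "ideal {\<zero>\<^bsub>tval T X\<^esub>} (tval T X)" by (rule X.zeroideal)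
next
  fix X Y :: "'a obj" and f assume X: "finite_gset G X" and Y: "finite_gset G Y" and f: "f \<in> gmaps G X Y"
  interpret X: cring "tval T X" by (rule cring_val[OF X])
  interpret Y: cring "tval T Y" by (rule cring_val[OF Y])
  have "tres T X Y f \<zero>\<^bsub>tval T Y\<^esub> = \<zero>\<^bsub>tval T X\<^esub>"
  proof (rule mark_ext)
    show "tres T X Y f \<zero>\<^bsub>tval T Y\<^esub> \<in> carrier (burnside_ring G X)"
      "\<zero>\<^bsub>tval T X\<^esub> \<in> carrier (burnside_ring G X)"
      using res_closed[OF X Y f Y.zero_closed] X.zero_closed by (simp_all add: val_burnside[OF X])
    fix S :: "'a obj" and e assume S: "transitive_gset G S" "e \<in> gmaps G S X"
    show "mark G S e (tres T X Y f \<zero>\<^bsub>tval T Y\<^esub>) = mark G S e \<zero>\<^bsub>tval T X\<^esub>"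
      using mark_res[OF X Y f Y.zero_closed S] mark_zero[OF S]
        mark_zero[OF S(1) gmaps_compose[OF transitive_gsetD(1)[OF S(1)] S(2) f]]
      by (simp add: val_burnside X Y)
  qed
  then show "tres T X Y f ` {\<zero>\<^bsub>tval T Y\<^esub>} \<subseteq> {\<zero>\<^bsub>tval T X\<^esub>}" by simp
  have "ttr T X Y f \<zero>\<^bsub>tval T X\<^esub> = \<zero>\<^bsub>tval T Y\<^esub>"
  proof (rule mark_ext)
    show "ttr T X Y f \<zero>\<^bsub>tval T X\<^esub> \<in> carrier (burnside_ring G Y)"
      "\<zero>\<^bsub>tval T Y\<^esub> \<in> carrier (burnside_ring G Y)"
      using tr_closed[OF X Y f X.zero_closed] Y.zero_closed by (simp_all add: val_burnside[OF Y])
    fix S :: "'a obj" and e assume S: "transitive_gset G S" "e \<in> gmaps G S Y"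
    have "mark G S e' \<zero>\<^bsub>tval T X\<^esub> = 0" if "e' \<in> lifts G S e (X, f)" for e'
      using that mark_zero[OF S(1), of e' X] by (simp add: lifts_def val_burnside X)
    then show "mark G S e (ttr T X Y f \<zero>\<^bsub>tval T X\<^esub>) = mark G S e \<zero>\<^bsub>tval T Y\<^esub>"
      using mark_tr[OF X Y f X.zero_closed S] mark_zero[OF S] by (simp add: val_burnside[OF Y])
  qed
  then show "ttr T X Y f ` {\<zero>\<^bsub>tval T X\<^esub>} \<subseteq> {\<zero>\<^bsub>tval T Y\<^esub>}" by simp
  show "tnm T X Y f ` {\<zero>\<^bsub>tval T X\<^esub>} \<subseteq>
      tnm T X Y f \<zero>\<^bsub>tval T X\<^esub> <+\<^bsub>tval T Y\<^esub> {\<zero>\<^bsub>tval T Y\<^esub>}"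
    using nm_closed[OF X Y f X.zero_closed] by (simp add: a_l_coset_def')
qed

text \<open>Properness and primality are both read off from the mark at the point: it separates 0
  from 1, and, being multiplicative with integer values, it cannot vanish on a product of elements
  with nonzero marks.\<close>

lemma domain_like_burnside: "domain_like G T"
  unfolding domain_like_def tambara_prime_def
proof (intro conjI allI impI)
  show "tambara_ideal G T (\<lambda>X. {\<zero>\<^bsub>tval T X\<^esub>})" by (rule tambara_ideal_zero)
  interpret R: cring "tval T pt" by (rule cring_val[OF finite_pt])
  note val = val_burnside[OF finite_pt]
  have zero: "mark G pt (\<lambda>x\<in>{0}. x) \<zero>\<^bsub>tval T pt\<^esub> = 0"
    using mark_zero[OF transitive_point point_id] by (simp add: val)
  have "mark G pt (\<lambda>x\<in>{0}. x) \<one>\<^bsub>tval T pt\<^esub> = 1"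
    using mark_one[OF finite_pt transitive_point point_id] by (simp add: val)
  then have "carrier (tval T pt) \<noteq> {\<zero>\<^bsub>tval T pt\<^esub>}" using zero R.one_closed by force
  then show "\<exists>X. finite_gset G X \<and> {\<zero>\<^bsub>tval T X\<^esub>} \<noteq> carrier (tval T X)" using finite_pt by metis
  fix X Y :: "'a obj" and a b
  assume X: "transitive_gset G X" and Y: "transitive_gset G Y"
    and a: "a \<in> carrier (tval T X)" and b: "b \<in> carrier (tval T Y)"
    and le: "ideal_le G (ideal_mult G T (gen_ideal G T X a) (gen_ideal G T Y b)) (\<lambda>X. {\<zero>\<^bsub>tval T X\<^esub>})"
  show "a \<in> {\<zero>\<^bsub>tval T X\<^esub>} \<or> b \<in> {\<zero>\<^bsub>tval T Y\<^esub>}"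
  proof (rule ccontr)
    assume "\<not> ?thesis"
    then have ne: "a \<noteq> \<zero>\<^bsub>tval T X\<^esub>" "b \<noteq> \<zero>\<^bsub>tval T Y\<^esub>" by auto
    obtain v where v: "v \<in> gen_ideal G T X a pt" "v \<in> carrier (tval T pt)" "mark G pt (\<lambda>x\<in>{0}. x) v \<noteq> 0"
      by (rule gen_ideal_witness[OF transitive_gsetD(1)[OF X] a ne(1)])
    obtain w where w: "w \<in> gen_ideal G T Y b pt" "w \<in> carrier (tval T pt)" "mark G pt (\<lambda>x\<in>{0}. x) w \<noteq> 0"
      by (rule gen_ideal_witness[OF transitive_gsetD(1)[OF Y] b ne(2)])
    let ?id = "\<lambda>x\<in>pts pt. x"
    \<comment> \<open>The product of ideals consists of transfers of products, and the identity of
      the point exhibits the product itself as such a transfer.\<close>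
    have "v \<otimes>\<^bsub>tval T pt\<^esub> w = ttr T pt pt ?id (v \<otimes>\<^bsub>tval T pt\<^esub> w)"
      using plus.cov_id[OF finite_pt] v w by simp
    then have "v \<otimes>\<^bsub>tval T pt\<^esub> w \<in> ideal_mult G T (gen_ideal G T X a) (gen_ideal G T Y b) pt"
      unfolding ideal_mult_def using finite_pt gmaps_id[OF finite_pt] v(1) w(1) by blast
    then have "v \<otimes>\<^bsub>tval T pt\<^esub> w = \<zero>\<^bsub>tval T pt\<^esub>"
      using le finite_pt by (auto simp: ideal_le_def)
    then show False
      using mark_mult[OF v(2)[unfolded val] w(2)[unfolded val] transitive_point point_id] zero v(3) w(3)
      by (simp add: val)
  qed
qed

end

theorem theorem4p40:
  fixes G :: "('g, 'm) monoid_scheme"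
    and Omega :: "('g, 'g burnside_elt) tambara_data"
  assumes "group G"
    and "finite (carrier G)"
    and "burnside_tambara_functor G Omega"
  shows "domain_like G Omega"
proof -
  interpret burnside_on_group G Omega
    using assms by (intro burnside_on_group.intro)
  show ?thesis by (rule domain_like_burnside)
qed

end
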